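(* Let $X$ be a domain in $\mathbb{C}^n$. The product of projectively invariant kernels on $X$ is projectively invariant. Any rescalling of a projectively invariant kernel is projectively invariant. A power $K^s$ ($s\in\mathbb{R}$) of a projectively invariant kernel $K$ is projectively invariant, provided that it is well-defined and positive semi-definite. A compact-open limit (i.e. a limit in the compact-open topology) of projectively invariant kernels is projectively invariant.
   Context: A domain is an open connected set; $Aut(X)$ is the group of biholomorphisms of $X$ onto itself. A function $L:X\times X\to\mathbb{C}$ is sesqui-holomorphic if it is holomorphic in the first variable and antiholomorphic in the second; $L$ is non-degenerate if $L(x,x)>0$ for all $x\in X$; $L$ is positive semi-definite (a positive semi-definite kernel) if for any $x_1,\dots,x_m\in X$ the matrix $(L(x_i,x_j))_{i,j=1}^m$ is positive semi-definite. A non-degenerate function $M$ is a rescalling of a non-degenerate function $L$ if there is a function $\omega:X\to\mathbb{C}$ with $M(x,y)=\omega(x)\overline{\omega(y)}L(x,y)$ for all $x,y\in X$. For $\Phi:X\to X$, $[L\circ\Phi](x,y)=L(\Phi(x),\Phi(y))$. A sesqui-holomorphic non-degenerate function $L$ on $X$ is called projectively invariant if $L\circ\Phi$ is a rescalling of $L$ for every $\Phi\in Aut(X)$. The kernels under consideration (those called projectively invariant kernels) are sesqui-holomorphic, non-degenerate and positive semi-definite. The power $K^s$ is understood as a sesqui-holomorphic function on $X$ whose value at $(x,x)$ is the usual real power $K(x,x)^s$ for every $x\in X$; it is well-defined when such a function exists.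
   Formalization: The rescalling is assumed to be sesqui-holomorphic and the compact-open limit is assumed to be non-degenerate; without these the claims fail (a discontinuous factor ω; the constant kernels 1/k tending to 0). *)

theory Defs
  imports "HOL-Analysis.Analysis"
begin

text \<open>
  Functions on a set \<open>X\<close> are represented by total functions; all notions below only
  depend on their values on \<open>X\<close> (respectively on \<open>X \<times> X\<close>).
\<close>

text \<open>
  Holomorphy on an open subset of \<open>\<complex>\<^sup>n\<close>: Frechet differentiability over the reals with a
  complex-linear derivative (the derivative is already additive, being real-linear).
\<close>

definition holomorphic_fun_on :: "(complex ^ 'n \<Rightarrow> complex) \<Rightarrow> (complex ^ 'n) set \<Rightarrow> bool" where
  "holomorphic_fun_on f X \<longleftrightarrow>
     (\<forall>x\<in>X. \<exists>D. (f has_derivative D) (at x) \<and> (\<forall>c v. D (c *s v) = c * D v))"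

definition antiholomorphic_fun_on :: "(complex ^ 'n \<Rightarrow> complex) \<Rightarrow> (complex ^ 'n) set \<Rightarrow> bool" where
  "antiholomorphic_fun_on f X \<longleftrightarrow> holomorphic_fun_on (\<lambda>x. cnj (f x)) X"

definition holomorphic_map_on :: "(complex ^ 'n \<Rightarrow> complex ^ 'm) \<Rightarrow> (complex ^ 'n) set \<Rightarrow> bool" where
  "holomorphic_map_on \<Phi> X \<longleftrightarrow> (\<forall>i. holomorphic_fun_on (\<lambda>x. \<Phi> x $ i) X)"

definition Aut :: "(complex ^ 'n) set \<Rightarrow> (complex ^ 'n \<Rightarrow> complex ^ 'n) set" where
  "Aut X = {\<Phi>. bij_betw \<Phi> X X \<and> holomorphic_map_on \<Phi> X \<and> holomorphic_map_on (inv_into X \<Phi>) X}"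

definition sesqui_holomorphic ::
  "(complex ^ 'n) set \<Rightarrow> (complex ^ 'n \<Rightarrow> complex ^ 'n \<Rightarrow> complex) \<Rightarrow> bool" where
  "sesqui_holomorphic X L \<longleftrightarrow>
     (\<forall>y\<in>X. holomorphic_fun_on (\<lambda>x. L x y) X) \<and>
     (\<forall>x\<in>X. antiholomorphic_fun_on (\<lambda>y. L x y) X)"

definition nondegenerate :: "'a set \<Rightarrow> ('a \<Rightarrow> 'a \<Rightarrow> complex) \<Rightarrow> bool" where
  "nondegenerate X L \<longleftrightarrow> (\<forall>x\<in>X. L x x \<in> \<real> \<and> Re (L x x) > 0)"

text \<open>
  Positive semi-definiteness of an \<open>m \<times> m\<close> complex matrix (entries with indices \<open>< m\<close>).
  Real-valuedness of the quadratic form on all complex vectors makes the matrix Hermitian.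
\<close>

definition psd_matrix :: "nat \<Rightarrow> (nat \<Rightarrow> nat \<Rightarrow> complex) \<Rightarrow> bool" where
  "psd_matrix m A \<longleftrightarrow>
     (\<forall>c :: nat \<Rightarrow> complex.
        (\<Sum>i<m. \<Sum>j<m. cnj (c i) * A i j * c j) \<in> \<real> \<and>
        Re (\<Sum>i<m. \<Sum>j<m. cnj (c i) * A i j * c j) \<ge> 0)"

definition psd_kernel :: "'a set \<Rightarrow> ('a \<Rightarrow> 'a \<Rightarrow> complex) \<Rightarrow> bool" where
  "psd_kernel X L \<longleftrightarrow>
     (\<forall>m. \<forall>x :: nat \<Rightarrow> 'a. (\<forall>i<m. x i \<in> X) \<longrightarrow> psd_matrix m (\<lambda>i j. L (x i) (x j)))"

definition rescaling ::
  "'a set \<Rightarrow> ('a \<Rightarrow> 'a \<Rightarrow> complex) \<Rightarrow> ('a \<Rightarrow> 'a \<Rightarrow> complex) \<Rightarrow> bool" where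
  "rescaling X M L \<longleftrightarrow> nondegenerate X M \<and> nondegenerate X L \<and>
     (\<exists>\<omega> :: 'a \<Rightarrow> complex. \<forall>x\<in>X. \<forall>y\<in>X. M x y = \<omega> x * cnj (\<omega> y) * L x y)"

definition projectively_invariant ::
  "(complex ^ 'n) set \<Rightarrow> (complex ^ 'n \<Rightarrow> complex ^ 'n \<Rightarrow> complex) \<Rightarrow> bool" where
  "projectively_invariant X L \<longleftrightarrow> sesqui_holomorphic X L \<and> nondegenerate X L \<and>
     (\<forall>\<Phi>\<in>Aut X. rescaling X (\<lambda>x y. L (\<Phi> x) (\<Phi> y)) L)"

text \<open>
  Kernels are sesqui-holomorphic, non-degenerate and positive semi-definite. A rescaling of a
  kernel need not be sesqui-holomorphic (\<open>\<omega>\<close> is arbitrary), and a compact-open limit of kernels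
  need not be non-degenerate (it may be \<open>0\<close>); these two conditions are therefore hypotheses in
  statements about rescalings and limits of kernels.
\<close>

definition projectively_invariant_kernel ::
  "(complex ^ 'n) set \<Rightarrow> (complex ^ 'n \<Rightarrow> complex ^ 'n \<Rightarrow> complex) \<Rightarrow> bool" where
  "projectively_invariant_kernel X L \<longleftrightarrow> projectively_invariant X L \<and> psd_kernel X L"

text \<open>
  \<open>P\<close> is the power \<open>K\<^sup>s\<close>. A sesqui-holomorphic function on a domain is determined by its
  values on the diagonal, so there is at most one such \<open>P\<close> on \<open>X \<times> X\<close>; the power is
  well-defined iff such a \<open>P\<close> exists.
\<close>

definition is_kernel_power ::
  "(complex ^ 'n) set \<Rightarrow> (complex ^ 'n \<Rightarrow> complex ^ 'n \<Rightarrow> complex) \<Rightarrow> real \<Rightarrow>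
   (complex ^ 'n \<Rightarrow> complex ^ 'n \<Rightarrow> complex) \<Rightarrow> bool" where
  "is_kernel_power X K s P \<longleftrightarrow> sesqui_holomorphic X P \<and>
     (\<forall>x\<in>X. P x x = complex_of_real (Re (K x x) powr s))"

text \<open>
  The compact-open topology on the continuous functions on \<open>S\<close>. Taking \<open>C = {}\<close> shows
  that its underlying set consists of all functions continuous on \<open>S\<close>. For kernels
  \<open>S = X \<times> X\<close>; sesqui-holomorphic functions are jointly continuous there by Hartogs' theorem.
\<close>

definition compact_open_topology ::
  "'a::topological_space set \<Rightarrow> ('a \<Rightarrow> 'b::topological_space) topology" where
  "compact_open_topology S = topology_generated_by
     {{f. continuous_on S f \<and> f ` C \<subseteq> U} | C U. compact C \<and> C \<subseteq> S \<and> open U}"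

lemma topspace_compact_open_topology:
  "topspace (compact_open_topology S) = {f. continuous_on S f}"
proof -
  have "{f. continuous_on S f} \<in>
      {{f. continuous_on S f \<and> f ` C \<subseteq> U} | C U. compact C \<and> C \<subseteq> S \<and> open U}"
    by (rule CollectI, rule exI[of _ "{}"], rule exI[of _ UNIV]) auto
  then show ?thesis
    unfolding compact_open_topology_def topology_generated_by_topspace by blast
qed

end

theory Submission
  imports Defs "HOL-Complex_Analysis.Complex_Analysis"
begin

text \<open>
  Two non-degenerate positive semi-definite kernels on a domain are rescalings of each other iff
  they have the same cross ratios. This condition passes to pointwise limits, and it extends
  analytically from any non-empty open subset; locally, powers of a rescaling factor are available,
  and a sesqui-holomorphic function vanishing on the diagonal vanishes (Osgood's lemma gives the
  boundedness needed for joint differentiability). Products are covered by Schur's product theorem.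
\<close>

section \<open>Holomorphic functions of several variables\<close>

text \<open>A rescaling factor is merely asserted to exist: it is an arbitrary function, chosen anew
  for each automorphism and each kernel. Along a family of kernels such factors need not converge,
  and on a domain with non-trivial topology a factor may have no holomorphic s-th power. The cross
  ratio A(x,y) A(z,w) / (A(x,w) A(z,y)) does not change under rescaling, so comparing cross ratios
  removes the factor from the argument. To recover a factor one would like to use A(x,z) / B(x,z)
  with one fixed z, but kernels may vanish off the diagonal. So z is chosen generically for each
  finite set of points: a kernel is non-zero on the diagonal, and a holomorphic function that is not
  identically zero on a domain cannot vanish on a non-empty open subset. Positive semi-definiteness
  enters here through Hermitian symmetry, which turns a ratio in the second variable into the
  conjugate of one in the first. Of a power only the diagonal values are known, which is why
  uniqueness from the diagonal is needed.\<close>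

lemma bounded_linear_scalar_vec:
  "bounded_linear (\<lambda>c::complex. c *s (d::complex^'n))"
proof -
  have "linear (\<lambda>c::complex. c *s d)"
    by (rule linearI) (simp_all add: vec_eq_iff scaleR_conv_of_real[where 'a=complex] algebra_simps)
  then show ?thesis by (simp add: linear_linear)
qed

lemma norm_scalar_vec: "norm (c *s (d::complex^'n)) = cmod c * norm d"
  by (simp add: norm_vec_def norm_mult L2_set_right_distrib)

lemma holomorphic_fun_onD:
  assumes "holomorphic_fun_on f X" "x \<in> X"
  shows "\<exists>D. (f has_derivative D) (at x) \<and> (\<forall>c v. D (c *s v) = c * D v)"
  using assms unfolding holomorphic_fun_on_def by blast

lemma holomorphic_fun_on_subset:
  "holomorphic_fun_on f X \<Longrightarrow> Y \<subseteq> X \<Longrightarrow> holomorphic_fun_on f Y"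
  unfolding holomorphic_fun_on_def by blast

lemma holomorphic_fun_on_const: "holomorphic_fun_on (\<lambda>_. c) X"
  unfolding holomorphic_fun_on_def
  by (rule ballI, rule exI[of _ "\<lambda>_. 0"]) simp

lemma holomorphic_fun_on_diff:
  assumes "holomorphic_fun_on f X" "holomorphic_fun_on g X"
  shows "holomorphic_fun_on (\<lambda>x. f x - g x) X"
  unfolding holomorphic_fun_on_def
proof
  fix x assume x: "x \<in> X"
  obtain D where D: "(f has_derivative D) (at x)" "\<And>c v. D (c *s v) = c * D v"
    using holomorphic_fun_onD[OF assms(1) x] by blast
  obtain E where E: "(g has_derivative E) (at x)" "\<And>c v. E (c *s v) = c * E v"
    using holomorphic_fun_onD[OF assms(2) x] by blast
  show "\<exists>D. ((\<lambda>x. f x - g x) has_derivative D) (at x) \<and> (\<forall>c v. D (c *s v) = c * D v)"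
    by (rule exI[of _ "\<lambda>v. D v - E v"]) (simp add: D E has_derivative_diff right_diff_distrib)
qed

lemma holomorphic_fun_on_mult:
  assumes "holomorphic_fun_on f X" "holomorphic_fun_on g X"
  shows "holomorphic_fun_on (\<lambda>x. f x * g x) X"
  unfolding holomorphic_fun_on_def
proof
  fix x assume x: "x \<in> X"
  obtain D where D: "(f has_derivative D) (at x)" "\<And>c v. D (c *s v) = c * D v"
    using holomorphic_fun_onD[OF assms(1) x] by blast
  obtain E where E: "(g has_derivative E) (at x)" "\<And>c v. E (c *s v) = c * E v"
    using holomorphic_fun_onD[OF assms(2) x] by blast
  show "\<exists>D. ((\<lambda>x. f x * g x) has_derivative D) (at x) \<and> (\<forall>c v. D (c *s v) = c * D v)"
    using has_derivative_mult[OF D(1) E(1)]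
    by (intro exI[of _ "\<lambda>v. f x * E v + D v * g x"]) (simp add: D E algebra_simps)
qed

lemma holomorphic_fun_on_compose_field:
  assumes "holomorphic_fun_on f X" "\<And>x. x \<in> X \<Longrightarrow> h field_differentiable (at (f x))"
  shows "holomorphic_fun_on (\<lambda>x. h (f x)) X"
  unfolding holomorphic_fun_on_def
proof
  fix x assume x: "x \<in> X"
  obtain D where D: "(f has_derivative D) (at x)" "\<And>c v. D (c *s v) = c * D v"
    using holomorphic_fun_onD[OF assms(1) x] by blast
  obtain d where "(h has_derivative (*) d) (at (f x))"
    using assms(2)[OF x] unfolding field_differentiable_def has_field_derivative_def by blast
  from has_derivative_compose[OF D(1) this]
  show "\<exists>D. ((\<lambda>x. h (f x)) has_derivative D) (at x) \<and> (\<forall>c v. D (c *s v) = c * D v)"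
    by (intro exI[of _ "\<lambda>v. d * D v"]) (simp add: D)
qed

lemma holomorphic_fun_on_compose:
  assumes f: "holomorphic_fun_on f Y" and \<Phi>: "holomorphic_map_on \<Phi> X" and "\<Phi> ` X \<subseteq> Y"
  shows "holomorphic_fun_on (\<lambda>x. f (\<Phi> x)) X"
  unfolding holomorphic_fun_on_def
proof
  fix x assume x: "x \<in> X"
  have "\<forall>i. \<exists>D. ((\<lambda>x. \<Phi> x $ i) has_derivative D) (at x) \<and> (\<forall>c v. D (c *s v) = c * D v)"
    using \<Phi> x unfolding holomorphic_map_on_def holomorphic_fun_on_def by blast
  then obtain D where D: "\<And>i. ((\<lambda>x. \<Phi> x $ i) has_derivative D i) (at x)"
      "\<And>i c v. D i (c *s v) = c * D i v"
    by metis
  \<comment> \<open>Holomorphy of a map is componentwise, so its total derivative is assembled by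
    expanding \<Phi> in the standard basis.\<close>
  let ?D = "\<lambda>v. \<chi> i. D i v"
  have "((\<lambda>x. \<Sum>i\<in>UNIV. (\<Phi> x $ i) *s axis i 1) has_derivative
      (\<lambda>v. \<Sum>i\<in>UNIV. (D i v) *s axis i 1)) (at x)"
    by (intro has_derivative_sum
        bounded_linear.has_derivative[OF bounded_linear_scalar_vec] D)
  moreover have "(\<lambda>v. \<Sum>i\<in>UNIV. (D i v) *s axis i 1) = ?D"
    using basis_expansion[of "?D v" for v] by simp
  moreover have "(\<lambda>x. \<Sum>i\<in>UNIV. (\<Phi> x $ i) *s axis i 1) = \<Phi>"
    by (simp add: basis_expansion)
  ultimately have \<Phi>': "(\<Phi> has_derivative ?D) (at x)"
    by simp
  obtain E where E: "(f has_derivative E) (at (\<Phi> x))" "\<And>c v. E (c *s v) = c * E v"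
    using holomorphic_fun_onD[OF f, of "\<Phi> x"] x assms(3) by blast
  have "E (?D (c *s v)) = c * E (?D v)" for c v
  proof -
    have "?D (c *s v) = c *s ?D v" by (simp add: vec_eq_iff D)
    then show ?thesis by (simp add: E)
  qed
  then show "\<exists>D. ((\<lambda>x. f (\<Phi> x)) has_derivative D) (at x) \<and> (\<forall>c v. D (c *s v) = c * D v)"
    using has_derivative_compose[OF \<Phi>' E(1)] by blast
qed

lemma holomorphic_fun_on_imp_continuous_on:
  "holomorphic_fun_on f X \<Longrightarrow> continuous_on X f"
  unfolding holomorphic_fun_on_def continuous_on_eq_continuous_within
  by (meson continuous_at_imp_continuous_within has_derivative_continuous)

text \<open>The bridge to one complex variable: complex linearity of \<open>D\<close> turns the real
  derivative along a complex line into multiplication by the number \<open>D d\<close>.\<close>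

lemma has_field_derivative_along_line:
  fixes f :: "complex ^ 'n \<Rightarrow> complex"
  assumes "(f has_derivative D) (at (p + z *s d))" "\<And>c v. D (c *s v) = c * D v"
  shows "((\<lambda>\<zeta>. f (p + \<zeta> *s d)) has_field_derivative D d) (at z)"
proof -
  have "((\<lambda>\<zeta>. p + \<zeta> *s d) has_derivative (\<lambda>\<zeta>. 0 + \<zeta> *s d)) (at z)"
    by (intro has_derivative_add has_derivative_const
        bounded_linear_imp_has_derivative[OF bounded_linear_scalar_vec])
  from has_derivative_compose[OF this assms(1)] show ?thesis
    unfolding has_field_derivative_def by (simp add: assms(2) mult.commute[of _ "D d"])
qed

lemma holomorphic_along_line:
  assumes "holomorphic_fun_on f X" "\<And>z. z \<in> S \<Longrightarrow> p + z *s d \<in> X"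
  shows "(\<lambda>\<zeta>. f (p + \<zeta> *s d)) holomorphic_on S"
  unfolding holomorphic_on_def
proof
  fix z assume z: "z \<in> S"
  obtain D where D: "(f has_derivative D) (at (p + z *s d))" "\<And>c v. D (c *s v) = c * D v"
    using holomorphic_fun_onD[OF assms(1) assms(2)[OF z]] by blast
  show "(\<lambda>\<zeta>. f (p + \<zeta> *s d)) field_differentiable at z within S"
    using has_field_derivative_along_line[OF D]
      field_differentiable_def field_differentiable_at_within by blast
qed

text \<open>The interior \<open>Z\<close> of the zero set is relatively closed. In a ball about a
  limit point of \<open>Z\<close>, any point y is joined to a point z of \<open>Z\<close> by a
  complex line, and the one-variable identity theorem carries the zeros near z along that line to y.
  Connectedness then gives \<open>Z = X\<close>.\<close>

lemma holomorphic_fun_on_eq_zero: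
  assumes f: "holomorphic_fun_on f X" and X: "open X" "connected X"
    and U: "open U" "U \<noteq> {}" "U \<subseteq> X" "\<And>x. x \<in> U \<Longrightarrow> f x = 0" and x: "x \<in> X"
  shows "f x = 0"
proof -
  define Z where "Z = interior {x \<in> X. f x = 0}"
  have ZX: "Z \<subseteq> X" and Z0: "\<And>z. z \<in> Z \<Longrightarrow> f z = 0" and Zo: "open Z"
    unfolding Z_def using interior_subset by auto
  have "U \<subseteq> Z" unfolding Z_def using U by (intro interior_maximal) auto
  have loc: "p \<in> Z" if p: "p \<in> X" "p \<in> closure Z" for p
  proof -
    obtain r where r: "r > 0" "ball p r \<subseteq> X" using X p(1) open_contains_ball by blast
    obtain z where z: "z \<in> Z" "z \<in> ball p r"
      using p(2) r(1) unfolding closure_approachable by (auto simp: dist_commute)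
    have "f y = 0" if y: "y \<in> ball p r" for y
    proof -
      let ?l = "\<lambda>\<zeta>::complex. z + \<zeta> *s (y - z)"
      \<comment> \<open>The part of the line inside the ball is convex in the parameter, hence
        connected, as continuation from parameter 0 to parameter 1 requires.\<close>
      have aff: "convex (?l -` A)" if "convex A" for A
      proof (rule convexI)
        fix a b :: complex and u v :: real
        assume a: "a \<in> ?l -` A" "b \<in> ?l -` A" and uv: "0 \<le> u" "0 \<le> v" "u + v = 1"
        have "?l (u *\<^sub>R a + v *\<^sub>R b) = u *\<^sub>R ?l a + v *\<^sub>R ?l b"
        proof -
          have "z = u *\<^sub>R z + v *\<^sub>R z" using uv by (simp flip: scaleR_left_distrib)
          moreover have "(u *\<^sub>R a + v *\<^sub>R b) *s (y - z)
              = u *\<^sub>R (a *s (y - z)) + v *\<^sub>R (b *s (y - z))"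
            by (simp add: vec_eq_iff scaleR_conv_of_real[where 'a=complex] algebra_simps)
          ultimately show ?thesis by (simp add: scaleR_right_distrib)
        qed
        then show "u *\<^sub>R a + v *\<^sub>R b \<in> ?l -` A"
          using a uv that by (simp add: convexD)
      qed
      have cont: "continuous_on UNIV ?l"
        by (intro continuous_intros bounded_linear.continuous_on[OF bounded_linear_scalar_vec])
      have op: "open (?l -` A)" if "open A" for A
        using cont that by (simp add: open_vimage)
      have "f (?l 1) = 0"
      proof (rule analytic_continuation_open[OF op[of "Z \<inter> ball p r"] op[of "ball p r"],
            of             "\<lambda>\<zeta>. f (?l \<zeta>)" "\<lambda>_. 0" 1])
        show "?l -` (Z \<inter> ball p r) \<noteq> {}"
          by (rule ex_in_conv[THEN iffD1], rule exI[of _ 0]) (use z in simp)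
        show "connected (?l -` ball p r)" by (intro convex_connected aff) simp
        show "(\<lambda>\<zeta>. f (?l \<zeta>)) holomorphic_on ?l -` ball p r"
          by (rule holomorphic_along_line[OF f]) (use r in auto)
      qed (use y Z0 Zo in auto)
      then show ?thesis by simp
    qed
    then have "ball p r \<subseteq> Z" unfolding Z_def using r by (intro interior_maximal) auto
    then show ?thesis using r by auto
  qed
  have "Z \<noteq> {}" using \<open>U \<subseteq> Z\<close> U by auto
  have "closedin (top_of_set X) Z"
  proof -
    have "Z = X \<inter> closure Z" using ZX loc closure_subset[of Z] by blast
    then show ?thesis using closedin_closed_Int[OF closed_closure] by metis
  qed
  moreover have "openin (top_of_set X) Z" using Zo ZX X by (simp add: openin_open_eq)
  ultimately have "Z = X" using X(2) \<open>Z \<noteq> {}\<close> by (auto simp: connected_clopen)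
  then show ?thesis using Z0 x by blast
qed

lemma holomorphic_fun_on_prod:
  assumes "finite I" "\<And>i. i \<in> I \<Longrightarrow> holomorphic_fun_on (f i) X"
  shows "holomorphic_fun_on (\<lambda>x. \<Prod>i\<in>I. f i x) X"
  using assms
  by (induction I rule: finite_induct) (auto intro: holomorphic_fun_on_const holomorphic_fun_on_mult)

text \<open>The product of the functions treated so far is non-zero on a non-empty open set, and by
  the identity theorem the next function cannot vanish on all of it. This supplies the generic base
  points of the cross ratio argument.\<close>

lemma common_nonzero_point:
  assumes X: "open X" "connected X" "X \<noteq> {}" and "finite I"
    and "\<And>i. i \<in> I \<Longrightarrow> holomorphic_fun_on (f i) X"
    and "\<And>i. i \<in> I \<Longrightarrow> \<exists>x\<in>X. f i x \<noteq> 0"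
  shows "\<exists>x\<in>X. \<forall>i\<in>I. f i x \<noteq> 0"
  using assms(4-6)
proof (induction I rule: finite_induct)
  case empty
  then show ?case using X by auto
next
  case (insert i I)
  then obtain x where x: "x \<in> X" "\<forall>i\<in>I. f i x \<noteq> 0" by auto
  let ?g = "\<lambda>x. \<Prod>i\<in>I. f i x"
  have "continuous_on X ?g"
    using insert by (intro holomorphic_fun_on_imp_continuous_on holomorphic_fun_on_prod) auto
  then have "open (X \<inter> ?g -` (- {0}))"
    using X by (intro continuous_open_preimage) auto
  moreover have "x \<in> X \<inter> ?g -` (- {0})" using x insert by auto
  ultimately have "\<not> (\<forall>y\<in>X \<inter> ?g -` (- {0}). f i y = 0)"
    using holomorphic_fun_on_eq_zero[of "f i" X "X \<inter> ?g -` (- {0})"] insert.prems X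
    by (metis Int_lower1 empty_iff insertI1)
  then obtain y where "y \<in> X" "?g y \<noteq> 0" "f i y \<noteq> 0" by auto
  then show ?case using insert by auto
qed

section \<open>Sesqui-holomorphic functions vanishing on the diagonal\<close>

lemma norm_deriv_le:
  assumes "f holomorphic_on S" "cball z r \<subseteq> S" "0 < r" "\<And>w. w \<in> cball z r \<Longrightarrow> cmod (f w) \<le> M"
  shows "cmod (deriv f z) \<le> M / r"
proof -
  have "cmod ((deriv ^^ 1) f z) \<le> fact 1 * M / r ^ 1"
  proof (rule Cauchy_inequality)
    show "f holomorphic_on ball z r"
      using assms(1,2) ball_subset_cball holomorphic_on_subset by blast
    show "continuous_on (cball z r) f"
      using assms(1,2) holomorphic_on_imp_continuous_on holomorphic_on_subset by blast
  qed (use assms in \<open>auto simp: dist_norm\<close>)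
  then show ?thesis by simp
qed

text \<open>Two partial derivatives yield a total one as soon as one of them is jointly continuous.
  For the derivative in w this follows from Cauchy's estimates, which the uniform bound
  \<open>M\<close> makes uniform in the other variable.\<close>

lemma bounded_separately_holomorphic_has_derivative:
  fixes F :: "complex \<Rightarrow> complex \<Rightarrow> complex"
  assumes S: "open S" and T: "open T"
    and 1: "\<And>w. w \<in> T \<Longrightarrow> (\<lambda>s. F s w) holomorphic_on S"
    and 2: "\<And>s. s \<in> S \<Longrightarrow> F s holomorphic_on T"
    and M: "\<And>s w. s \<in> S \<Longrightarrow> w \<in> T \<Longrightarrow> cmod (F s w) \<le> M"
    and s0: "s0 \<in> S" and w0: "w0 \<in> T"
  shows "\<exists>D E. ((\<lambda>(s, w). F s w) has_derivative (\<lambda>(h, k). D * h + E * k)) (at (s0, w0))"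
proof -
  obtain e1 where e1: "e1 > 0" "cball s0 e1 \<subseteq> S" using S s0 open_contains_cball by blast
  obtain e2 where e2: "e2 > 0" "cball w0 e2 \<subseteq> T" using T w0 open_contains_cball by blast
  \<comment> \<open>Half the radius, so that closed discs of radius \<open>e\<close> about points of
    the discs of radius \<open>e\<close> stay in \<open>S\<close> and \<open>T\<close>.\<close>
  define e where "e = min e1 e2 / 2"
  have e: "e > 0" "2 * e \<le> e1" "2 * e \<le> e2" using e1 e2 by (auto simp: e_def)
  have cS: "cball z e \<subseteq> S" if "z \<in> ball s0 e" for z
  proof -
    have "cball z e \<subseteq> cball s0 e1" using that e by (intro cball_subset_cball_iff[THEN iffD2]) (auto simp: dist_commute)
    then show ?thesis using e1 by blast
  qed
  have cT: "cball z e \<subseteq> T" if "z \<in> ball w0 e" for z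
  proof -
    have "cball z e \<subseteq> cball w0 e2" using that e by (intro cball_subset_cball_iff[THEN iffD2]) (auto simp: dist_commute)
    then show ?thesis using e2 by blast
  qed
  have bS: "z \<in> S" if "z \<in> ball s0 e" for z using cS[OF that] e by auto
  have bT: "z \<in> T" if "z \<in> ball w0 e" for z using cT[OF that] e by auto
  have lip: "cmod (F s w - F s0 w) \<le> M / e * cmod (s - s0)" if "s \<in> ball s0 e" "w \<in> T" for s w
  proof (rule field_differentiable_bound[of "ball s0 e" "\<lambda>s. F s w" "deriv (\<lambda>s. F s w)"])
    fix z assume z: "z \<in> ball s0 e"
    show "((\<lambda>s. F s w) has_field_derivative deriv (\<lambda>s. F s w) z) (at z within ball s0 e)"
      using holomorphic_derivI[OF 1[OF that(2)] S bS[OF z]] .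
    show "cmod (deriv (\<lambda>s. F s w) z) \<le> M / e"
      by (rule norm_deriv_le[OF 1[OF that(2)] cS[OF z] e(1)]) (use cS[OF z] M that in auto)
  qed (use that e in auto)
  \<comment> \<open>A second Cauchy estimate, now in w, for the difference
    \<open>F s - F s0\<close>, whose size is controlled by \<open>lip\<close>.\<close>
  have dlip: "cmod (deriv (F s) w - deriv (F s0) w) \<le> M / e / e * cmod (s - s0)"
    if s: "s \<in> ball s0 e" and w: "w \<in> ball w0 e" for s w
  proof -
    have "(\<lambda>w. F s w - F s0 w) holomorphic_on T"
      using 2 bS[OF s] s0 by (intro holomorphic_intros) auto
    then have "cmod (deriv (\<lambda>w. F s w - F s0 w) w) \<le> (M / e * cmod (s - s0)) / e"
      by (rule norm_deriv_le[OF _ cT[OF w] e(1)]) (use lip[OF s] cT[OF w] in blast)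
    moreover have "deriv (\<lambda>w. F s w - F s0 w) w = deriv (F s) w - deriv (F s0) w"
      by (intro deriv_diff holomorphic_on_imp_differentiable_at[OF 2 T bT[OF w]] bS[OF s] s0)
    ultimately show ?thesis by simp
  qed
  let ?B = "ball s0 e \<times> ball w0 e"
  have A: "((\<lambda>p. deriv (F s0) (snd p)) \<longlongrightarrow> deriv (F s0) w0) (at (s0, w0) within ?B)"
  proof -
    have "isCont (deriv (F s0)) w0"
      using holomorphic_on_imp_continuous_on[OF holomorphic_deriv[OF 2[OF s0] T]]
        continuous_on_eq_continuous_at[OF T] w0 by blast
    moreover have "(snd \<longlongrightarrow> w0) (at (s0, w0) within ?B)"
      using tendsto_snd[OF tendsto_ident_at[of "(s0, w0)" ?B]] by simp
    ultimately show ?thesis by (rule isCont_tendsto_compose)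
  qed
  have Bz: "((\<lambda>p. deriv (F (fst p)) (snd p) - deriv (F s0) (snd p)) \<longlongrightarrow> 0) (at (s0, w0) within ?B)"
  proof (rule Lim_null_comparison)
    show "\<forall>\<^sub>F p in at (s0, w0) within ?B. norm (deriv (F (fst p)) (snd p) - deriv (F s0) (snd p))
        \<le> M / e / e * cmod (fst p - s0)"
      unfolding eventually_at_filter by (rule always_eventually) (use dlip in auto)
    have "(fst \<longlongrightarrow> s0) (at (s0, w0) within ?B)"
      using tendsto_fst[OF tendsto_ident_at[of "(s0, w0)" ?B]] by simp
    then have "((\<lambda>p. M / e / e * cmod (fst p - s0)) \<longlongrightarrow> M / e / e * cmod (s0 - s0)) (at (s0, w0) within ?B)"
      by (intro tendsto_intros)
    then show "((\<lambda>p. M / e / e * cmod (fst p - s0)) \<longlongrightarrow> 0) (at (s0, w0) within ?B)" by simp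
  qed
  have "((\<lambda>p. deriv (F (fst p)) (snd p)) \<longlongrightarrow> deriv (F s0) w0) (at (s0, w0) within ?B)"
    using tendsto_add[OF Bz A] by simp
  then have C: "continuous (at (s0, w0) within ?B) (\<lambda>(s, w). blinfun_mult_right (deriv (F s) w))"
    unfolding continuous_within split_beta'
    using bounded_linear.tendsto[OF bounded_linear_blinfun_mult_right] by force
  have "((\<lambda>(s, w). F s w) has_derivative
      (\<lambda>(h, k). deriv (\<lambda>s. F s w0) s0 * h + blinfun_mult_right (deriv (F s0) w0) k)) (at (s0, w0) within ?B)"
  proof (rule has_derivative_partialsI[OF _ _ C])
    show "((\<lambda>s. F s w0) has_derivative (*) (deriv (\<lambda>s. F s w0) s0)) (at s0 within ball s0 e)"
      using holomorphic_derivI[OF 1[OF w0] S s0] has_field_derivative_def by blast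
    fix s w assume "s \<in> ball s0 e" "w \<in> ball w0 e"
    then show "(F s has_derivative blinfun_apply (blinfun_mult_right (deriv (F s) w))) (at w within ball w0 e)"
      using holomorphic_derivI[OF 2 T bT] bS unfolding has_field_derivative_def by simp
  qed (use e in auto)
  moreover have "at (s0, w0) within ?B = at (s0, w0)"
    by (intro at_within_open) (use e in \<open>auto intro: open_Times\<close>)
  ultimately show ?thesis by auto
qed

lemma holomorphic_on_ball_eq_zero_of_real:
  assumes f: "f holomorphic_on ball 0 r" and "\<And>x::real. \<bar>x\<bar> < r \<Longrightarrow> f (of_real x) = 0"
    and z: "z \<in> ball 0 r"
  shows "f z = 0"
proof -
  have r: "r > 0" using z by (smt (verit) ball_eq_empty empty_iff)
  show ?thesis
  proof (rule analytic_continuation[OF f, of "of_real ` {-r<..<r}" 0])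
    \<comment> \<open>Non-zero real points of the disc that accumulate at its centre.\<close>
    define q where "q n = r / 2 / real (Suc n)" for n
    have "q \<longlonglongrightarrow> 0" unfolding q_def by real_asymp
    then have "(\<lambda>n. of_real (q n) :: complex) \<longlonglongrightarrow> of_real 0"
      by (rule tendsto_of_real)
    moreover have "q n \<in> {-r<..<r} - {0}" for n
      unfolding q_def using r by (auto simp: field_simps) (smt (verit) mult_nonneg_nonneg of_nat_0_le_iff)+
    ultimately show "0 islimpt complex_of_real ` {-r<..<r}"
      unfolding islimpt_sequential
      by (intro exI[of _ "\<lambda>n. of_real (q n)"]) auto
  qed (use assms r in auto)
qed

text \<open>On the diagonal \<open>H (a + \<i> b) (a + \<i> b) = F (a + \<i> b) (a - \<i> b)\<close> for real \<open>a\<close>, \<open>b\<close>,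
  where \<open>F s w = H s (cnj w)\<close> is holomorphic in both variables; so \<open>a\<close> and then \<open>b\<close> may be
  replaced by complex numbers.\<close>

lemma sesqui_holomorphic_disc_eq_zero:
  fixes H :: "complex \<Rightarrow> complex \<Rightarrow> complex"
  assumes 1: "\<And>t. t \<in> ball 0 1 \<Longrightarrow> (\<lambda>s. H s t) holomorphic_on ball 0 1"
    and 2: "\<And>s. s \<in> ball 0 1 \<Longrightarrow> (\<lambda>t. cnj (H s t)) holomorphic_on ball 0 1"
    and M: "\<And>s t. s \<in> ball 0 1 \<Longrightarrow> t \<in> ball 0 1 \<Longrightarrow> cmod (H s t) \<le> M"
    and 0: "\<And>s. s \<in> ball 0 1 \<Longrightarrow> H s s = 0"
    and st: "s \<in> ball 0 (1/2)" "t \<in> ball 0 (1/2)"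
  shows "H s t = 0"
proof -
  define F where "F s w = H s (cnj w)" for s w
  let ?D = "ball 0 1 :: complex set"
  have F1: "(\<lambda>s. F s w) holomorphic_on ?D" if "w \<in> ?D" for w
    unfolding F_def using 1[of "cnj w"] that by simp
  have F2: "F s holomorphic_on ?D" if "s \<in> ?D" for s
  proof -
    have im: "cnj ` ?D \<subseteq> ?D" by auto
    have "cnj \<circ> (\<lambda>t. cnj (H s t)) \<circ> cnj holomorphic_on ?D"
      by (rule holomorphic_on_compose_cnj_cnj[OF holomorphic_on_subset[OF 2[OF that] im]]) simp
    then show ?thesis by (simp add: F_def[abs_def] o_def)
  qed
  \<comment> \<open>Joint differentiability makes \<open>F\<close> holomorphic along every complex
    line in the bidisc, not only along lines parallel to the axes.\<close>
  have hol: "(\<lambda>z. F (z * \<alpha> + \<beta>) (z * \<gamma> + \<delta>)) holomorphic_on ball 0 r"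
    if in_disc: "\<And>z. z \<in> ball 0 r \<Longrightarrow> z * \<alpha> + \<beta> \<in> ?D \<and> z * \<gamma> + \<delta> \<in> ?D" for \<alpha> \<beta> \<gamma> \<delta> :: complex and r
    unfolding holomorphic_on_open[OF open_ball]
  proof
    fix z :: complex assume z: "z \<in> ball 0 r"
    obtain d e where de: "((\<lambda>(s, w). F s w) has_derivative (\<lambda>(h, k). d * h + e * k))
        (at (z * \<alpha> + \<beta>, z * \<gamma> + \<delta>))"
      using bounded_separately_holomorphic_has_derivative[of ?D ?D F M "z * \<alpha> + \<beta>" "z * \<gamma> + \<delta>"]
        F1 F2 M in_disc[OF z] by (auto simp: F_def)
    have "((\<lambda>z. (z * \<alpha> + \<beta>, z * \<gamma> + \<delta>)) has_derivative (\<lambda>h. (h * \<alpha>, h * \<gamma>))) (at z)"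
      by (auto intro!: derivative_eq_intros)
    from has_derivative_compose[OF this de]
    have "((\<lambda>z. F (z * \<alpha> + \<beta>) (z * \<gamma> + \<delta>)) has_field_derivative (d * \<alpha> + e * \<gamma>)) (at z)"
      unfolding has_field_derivative_def prod.case
      by (rule has_derivative_eq_rhs) (auto simp: algebra_simps)
    then show "\<exists>f'. ((\<lambda>z. F (z * \<alpha> + \<beta>) (z * \<gamma> + \<delta>)) has_field_derivative f') (at z)" by blast
  qed
  have tri: "cmod (u + v) < 1" "cmod (u - v) < 1" if "cmod u < 1/2" "cmod v < 1/2" for u v
    using norm_triangle_ineq[of u v] norm_triangle_ineq4[of u v] that by linarith+
  have step1: "F (a + \<i> * of_real b) (a - \<i> * of_real b) = 0"
    if a: "a \<in> ball 0 (1/2)" and b: "\<bar>b\<bar> < 1/2" for a :: complex and b :: real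
  proof -
    let ?f = "\<lambda>z. F (z * 1 + \<i> * of_real b) (z * 1 + (- \<i> * of_real b))"
    have "?f a = 0"
    proof (rule holomorphic_on_ball_eq_zero_of_real[of ?f, OF _ _ a], rule hol)
      show "z * 1 + \<i> * of_real b \<in> ?D \<and> z * 1 + (- \<i> * of_real b) \<in> ?D" if "z \<in> ball 0 (1/2)" for z
        using tri[of z "\<i> * of_real b"] that b by (simp add: norm_mult)
      show "F (of_real x * 1 + \<i> * of_real b) (of_real x * 1 + (- \<i> * of_real b)) = 0" if "\<bar>x\<bar> < 1/2" for x
        using 0[of "of_real x + \<i> * of_real b"] tri[of "of_real x" "\<i> * of_real b"] that b
        by (simp add: F_def norm_mult)
    qed
    then show ?thesis by simp
  qed
  have step2: "F (a + \<i> * b) (a - \<i> * b) = 0"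
    if a: "a \<in> ball 0 (1/2)" and b: "b \<in> ball 0 (1/2)" for a b :: complex
  proof -
    let ?f = "\<lambda>z. F (z * \<i> + a) (z * (-\<i>) + a)"
    have "?f b = 0"
    proof (rule holomorphic_on_ball_eq_zero_of_real[of ?f, OF _ _ b], rule hol)
      show "z * \<i> + a \<in> ?D \<and> z * (-\<i>) + a \<in> ?D" if "z \<in> ball 0 (1/2)" for z
        using tri[of a "z * \<i>"] that a by (simp add: norm_mult add.commute)
      show "F (of_real x * \<i> + a) (of_real x * (-\<i>) + a) = 0" if "\<bar>x\<bar> < 1/2" for x
        using step1[OF a that] by (simp add: algebra_simps)
    qed
    then show ?thesis by (simp add: algebra_simps)
  qed
  \<comment> \<open>The solution of \<open>a + \<i> * b = s\<close> and
    \<open>a - \<i> * b = cnj t\<close>. Both moduli are at most the mean of those of s and t, which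
    is why s and t are taken in the disc of radius 1/2.\<close>
  define a b where "a = (s + cnj t) / 2" and "b = (s - cnj t) / (2 * \<i>)"
  have "cmod (s + cnj t) < 1" "cmod (s - cnj t) < 1" using tri[of s "cnj t"] st by auto
  then have ab: "a \<in> ball 0 (1/2)" "b \<in> ball 0 (1/2)"
    by (auto simp: a_def b_def norm_divide norm_mult)
  have "F s (cnj t) = 0"
  proof -
    have "a + \<i> * b = s" "a - \<i> * b = cnj t" unfolding a_def b_def by (simp_all add: field_simps)
    then show ?thesis using step2[OF ab] by simp
  qed
  then show ?thesis by (simp add: F_def)
qed

text \<open>Osgood's lemma: Baire's theorem for the sets of all \<open>x\<close> with \<open>\<bar>G x y\<bar> \<le> N\<close> for all \<open>y\<close>.\<close>

lemma separately_continuous_bounded_on_ball: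
  fixes G :: "'a::euclidean_space \<Rightarrow> 'a \<Rightarrow> 'b::real_normed_vector"
  assumes U: "open U" "U \<noteq> {}"
    and 1: "\<And>y. y \<in> U \<Longrightarrow> continuous_on U (\<lambda>x. G x y)"
    and 2: "\<And>x. x \<in> U \<Longrightarrow> continuous_on U (G x)"
  shows "\<exists>b r M. 0 < r \<and> ball b r \<subseteq> U \<and> (\<forall>x\<in>ball b r. \<forall>y\<in>ball b r. norm (G x y) \<le> M)"
proof -
  obtain a r where r: "r > 0" "cball a r \<subseteq> U" using U open_contains_cball by blast
  define E where "E N = {x \<in> cball a r. \<forall>y\<in>cball a r. norm (G x y) \<le> real N}" for N
  have Ecl: "closed (E N)" for N
  proof -
    have "closed {x \<in> cball a r. norm (G x y) \<le> real N}" if "y \<in> cball a r" for y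
      using that r
      by (intro continuous_on_closed_Collect_le continuous_on_norm continuous_on_const
          closed_cball continuous_on_subset[OF 1]) auto
    moreover have "E N = (\<Inter>y\<in>cball a r. {x \<in> cball a r. norm (G x y) \<le> real N})"
    proof -
      have "a \<in> cball a r" using r by simp
      then show ?thesis unfolding E_def by blast
    qed
    ultimately show ?thesis by auto
  qed
  have "\<exists>N. interior (E N) \<noteq> {}"
  proof (rule ccontr)
    \<comment> \<open>Then the complements are open and dense, so some x near \<open>a\<close> lies
      in no \<open>E N\<close>; but \<open>G x\<close> is continuous, hence bounded, on the compact
      ball.\<close>
    assume "\<nexists>N. interior (E N) \<noteq> {}"
    then have "UNIV \<subseteq> closure (\<Inter>N. - E N)"
      by (intro Baire) (auto simp: closure_complement Ecl open_Compl)
    then have "a \<in> closure (\<Inter>N. - E N)" by blast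
    then obtain x where "x \<in> (\<Inter>N. - E N)" "dist x a < r"
      using r(1) unfolding closure_approachable by blast
    then have x: "x \<in> ball a r" "\<And>N. x \<notin> E N" by (auto simp: dist_commute)
    have "compact (G x ` cball a r)"
      using x r by (intro compact_continuous_image continuous_on_subset[OF 2]) auto
    then obtain B where B: "\<And>y. y \<in> cball a r \<Longrightarrow> norm (G x y) \<le> B"
      by (meson bounded_iff compact_imp_bounded image_eqI)
    obtain N where "B \<le> real N" using real_arch_simple by blast
    then have "x \<in> E N" using x(1) B unfolding E_def by force
    then show False using x(2) by blast
  qed
  then obtain N b where "b \<in> interior (E N)" by blast
  then obtain e where e: "e > 0" "ball b e \<subseteq> E N" using mem_interior by blast
  have "E N \<subseteq> cball a r" unfolding E_def by auto
  then have sub: "ball b e \<subseteq> cball a r" using e(2) by simp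
  have "norm (G x y) \<le> real N" if "x \<in> ball b e" "y \<in> ball b e" for x y
    using subsetD[OF e(2) that(1)] subsetD[OF sub that(2)] unfolding E_def by simp
  then show ?thesis
    using e(1) subset_trans[OF sub r(2)] by blast
qed

lemma sesqui_holomorphic_subset:
  "sesqui_holomorphic X L \<Longrightarrow> Y \<subseteq> X \<Longrightarrow> sesqui_holomorphic Y L"
  unfolding sesqui_holomorphic_def antiholomorphic_fun_on_def
  by (meson holomorphic_fun_on_subset subset_iff)

text \<open>Two nearby points lie on a common complex line, where the one-variable lemma applies
  once \<open>G\<close> is bounded. Osgood's lemma bounds \<open>G\<close> only on some ball in
  \<open>U\<close>, whence the smaller set \<open>V\<close>.\<close>

lemma sesqui_holomorphic_diagonal_zero:
  fixes G :: "complex ^ 'n \<Rightarrow> complex ^ 'n \<Rightarrow> complex"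
  assumes U: "open U" "U \<noteq> {}" and G: "sesqui_holomorphic U G" and 0: "\<And>x. x \<in> U \<Longrightarrow> G x x = 0"
  shows "\<exists>V. open V \<and> V \<noteq> {} \<and> V \<subseteq> U \<and> (\<forall>x\<in>V. \<forall>y\<in>V. G x y = 0)"
proof -
  have G1: "holomorphic_fun_on (\<lambda>x. G x y) U" if "y \<in> U" for y
    using G that unfolding sesqui_holomorphic_def by blast
  have G2: "holomorphic_fun_on (\<lambda>y. cnj (G x y)) U" if "x \<in> U" for x
    using G that unfolding sesqui_holomorphic_def antiholomorphic_fun_on_def by blast
  have "continuous_on U (G x)" if "x \<in> U" for x
    using continuous_on_cnj[OF holomorphic_fun_on_imp_continuous_on[OF G2[OF that]]] by simp
  then obtain b r M where r: "0 < r" "ball b r \<subseteq> U"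
      and M: "\<And>x y. x \<in> ball b r \<Longrightarrow> y \<in> ball b r \<Longrightarrow> cmod (G x y) \<le> M"
    using separately_continuous_bounded_on_ball[OF U, of G]
      holomorphic_fun_on_imp_continuous_on[OF G1] by blast
  have "G x y = 0" if x: "x \<in> ball b (r/5)" and y: "y \<in> ball b (r/5)" for x y
  proof -
    \<comment> \<open>The line through the midpoint reaches x and y at the parameters -1/4 and 1/4,
      inside the disc of radius 1/2. The unit disc of parameters stays in \<open>ball b r\<close>,
      since r/5 + 4r/5 = r.\<close>
    define m where "m = (1/2) *\<^sub>R (x + y)"
    define d where "d = (2::real) *\<^sub>R (y - x)"
    have m: "dist b m < r / 5"
      using convexD[OF convex_ball x y, of "1/2" "1/2"] by (simp add: m_def scaleR_right_distrib)
    have "norm (y - x) < 2 * r / 5"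
      using x y dist_triangle[of y x b] by (simp add: dist_norm norm_minus_commute)
    then have d: "norm d < 4 * r / 5" by (simp add: d_def)
    have line: "m + z *s d \<in> ball b r" if "z \<in> ball 0 1" for z
    proof -
      have "norm (z *s d) \<le> 1 * norm d"
        unfolding norm_scalar_vec using that by (intro mult_right_mono) auto
      moreover have "dist b (m + z *s d) \<le> dist b m + norm (z *s d)"
        by (metis add_diff_cancel_left' dist_norm dist_triangle norm_minus_commute)
      ultimately show ?thesis using m d by simp
    qed
    let ?H = "\<lambda>s t. G (m + s *s d) (m + t *s d)"
    have "?H (-(1/4)) (1/4) = 0"
    proof (rule sesqui_holomorphic_disc_eq_zero[of ?H M])
      show "(\<lambda>s. ?H s t) holomorphic_on ball 0 1" if "t \<in> ball 0 1" for t
        by (rule holomorphic_along_line[OF G1]) (use line that r in blast)+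
      show "(\<lambda>t. cnj (?H s t)) holomorphic_on ball 0 1" if "s \<in> ball 0 1" for s
        by (rule holomorphic_along_line[OF G2]) (use line that r in blast)+
      show "?H s s = 0" if "s \<in> ball 0 1" for s
        by (rule 0) (rule subsetD[OF r(2) line[OF that]])
      show "cmod (?H s t) \<le> M" if "s \<in> ball 0 1" "t \<in> ball 0 1" for s t
        by (rule M[OF line line]) (fact that)+
    qed auto
    moreover have "m + (-(1/4)) *s d = x" "m + (1/4) *s d = y"
      by (simp_all add: m_def d_def vec_eq_iff scaleR_conv_of_real[where 'a=complex] field_simps)
    ultimately show ?thesis by simp
  qed
  then show ?thesis
    using r by (intro exI[of _ "ball b (r/5)"]) auto
qed

section \<open>Compact-open limits\<close>

text \<open>Cauchy's estimate on the complex line through x in direction v, on which the parameter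
  disc of radius \<open>r / norm v\<close> stays in the ball.\<close>

lemma holomorphic_fun_on_norm_derivative_le:
  assumes f: "holomorphic_fun_on f X" and X: "cball x r \<subseteq> X" and r: "0 < r"
    and M: "\<And>y. y \<in> cball x r \<Longrightarrow> cmod (f y) \<le> M"
    and D: "(f has_derivative D) (at x)" "\<And>c v. D (c *s v) = c * D v"
  shows "cmod (D v) \<le> M / r * norm v"
proof (cases "v = 0")
  case True
  then show ?thesis using D(2)[of 0 0] by simp
next
  case False
  then have v: "0 < r / norm v" using r by simp
  have line: "x + z *s v \<in> cball x r" if "z \<in> cball 0 (r / norm v)" for z
    using that False by (simp add: norm_scalar_vec dist_norm field_simps)
  have "cmod (deriv (\<lambda>\<zeta>. f (x + \<zeta> *s v)) 0) \<le> M / (r / norm v)"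
    by (rule norm_deriv_le[OF holomorphic_along_line[OF f] order_refl v]) (use line X M in auto)
  moreover have "deriv (\<lambda>\<zeta>. f (x + \<zeta> *s v)) 0 = D v"
    by (rule DERIV_imp_deriv[OF has_field_derivative_along_line]) (use D in auto)
  ultimately show ?thesis by simp
qed

text \<open>Weierstrass' theorem: Cauchy's estimate for differences makes the derivatives uniformly
  Cauchy as linear maps near a point, so the limit may be differentiated, and complex linearity
  passes to the limit of the derivatives.\<close>

lemma holomorphic_fun_on_uniform_limit:
  fixes f :: "'i \<Rightarrow> complex ^ 'n \<Rightarrow> complex"
  assumes X: "open X" and F: "F \<noteq> bot"
    and hol: "\<forall>\<^sub>F i in F. holomorphic_fun_on (f i) X"
    and lim: "\<And>C. compact C \<Longrightarrow> C \<subseteq> X \<Longrightarrow> uniform_limit C f g F"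
  shows "holomorphic_fun_on g X"
  unfolding holomorphic_fun_on_def
proof
  fix a assume a: "a \<in> X"
  obtain e where e: "e > 0" "cball a e \<subseteq> X" using X a open_contains_cball by blast
  define r where "r = e / 2"
  have r: "r > 0" using e by (simp add: r_def)
  have sub: "cball x r \<subseteq> cball a e" if "x \<in> ball a r" for x
    using that by (intro cball_subset_cball_iff[THEN iffD2]) (auto simp: r_def dist_commute)
  have subE: "x \<in> cball a e" if "x \<in> ball a r" for x
    using that e by (simp add: r_def)
  have subX: "x \<in> X" if "x \<in> ball a r" for x
    using subE[OF that] e(2) by blast
  \<comment> \<open>The filter is arbitrary, whereas differentiation of limits is applied to a
    sequence; so one is picked that approximates \<open>g\<close> on the closed ball.\<close>
  have "\<exists>h. holomorphic_fun_on h X \<and> (\<forall>x\<in>cball a e. dist (h x) (g x) < 1 / real (Suc n))" for n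
  proof -
    have "\<forall>\<^sub>F i in F. \<forall>x\<in>cball a e. dist (f i x) (g x) < 1 / real (Suc n)"
      using lim[of "cball a e"] e by (intro uniform_limitD) auto
    then have "\<forall>\<^sub>F i in F. holomorphic_fun_on (f i) X \<and> (\<forall>x\<in>cball a e. dist (f i x) (g x) < 1 / real (Suc n))"
      using hol eventually_conj by blast
    then show ?thesis using F eventually_happens' by blast
  qed
  then obtain h where h: "\<And>n. holomorphic_fun_on (h n) X"
      and hg: "\<And>n x. x \<in> cball a e \<Longrightarrow> dist (h n x) (g x) < 1 / real (Suc n)"
    by metis
  have "\<forall>n. \<forall>x\<in>X. \<exists>D. (h n has_derivative D) (at x) \<and> (\<forall>c v. D (c *s v) = c * D v)"
    using h unfolding holomorphic_fun_on_def by blast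
  then obtain D where D: "\<And>n x. x \<in> X \<Longrightarrow> (h n has_derivative D n x) (at x)"
      "\<And>n x c v. x \<in> X \<Longrightarrow> D n x (c *s v) = c * D n x v"
    by metis
  have cauchy: "cmod (D n x v - D m x v) \<le> 2 / real (Suc k) / r * norm v"
    if x: "x \<in> ball a r" and nm: "n \<ge> k" "m \<ge> k" for x v n m k
  proof (rule holomorphic_fun_on_norm_derivative_le[where D = "\<lambda>v. D n x v - D m x v"])
    have xX: "x \<in> X" by (rule subX[OF x])
    show "holomorphic_fun_on (\<lambda>x. h n x - h m x) X"
      by (intro holomorphic_fun_on_diff h)
    show "((\<lambda>x. h n x - h m x) has_derivative (\<lambda>v. D n x v - D m x v)) (at x)"
      by (intro has_derivative_diff D xX)
    show "D n x (c *s w) - D m x (c *s w) = c * (D n x w - D m x w)" for c w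
      by (simp add: D xX right_diff_distrib)
    show "cmod (h n y - h m y) \<le> 2 / real (Suc k)" if "y \<in> cball x r" for y
    proof -
      have y: "y \<in> cball a e" using sub[OF x] that by blast
      have "1 / real (Suc n) \<le> 1 / real (Suc k)" "1 / real (Suc m) \<le> 1 / real (Suc k)"
        using nm by (auto intro!: divide_left_mono)
      then show ?thesis
        using hg[OF y, of n] hg[OF y, of m] dist_triangle2[of "h n y" "h m y" "g y"]
        by (simp add: dist_norm)
    qed
  qed (use sub[OF x] e r in auto)
  have small: "\<exists>k. 2 / real (Suc k) / r < \<epsilon>" if "\<epsilon> > 0" for \<epsilon>
  proof -
    have "0 < \<epsilon> * r / 2" using that r by simp
    then obtain k where "inverse (real (Suc k)) < \<epsilon> * r / 2"
      using reals_Archimedean by blast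
    then have "2 / real (Suc k) < \<epsilon> * r"
      unfolding divide_inverse[of 2 "real (Suc k)"] by linarith
    then have "2 / real (Suc k) / r < \<epsilon>"
      unfolding pos_divide_less_eq[OF r] .
    then show ?thesis by blast
  qed
  have "convergent (\<lambda>n. D n x v)" if x: "x \<in> ball a r" for x v
  proof (rule Cauchy_convergent, rule metric_CauchyI)
    fix \<epsilon> :: real assume "\<epsilon> > 0"
    \<comment> \<open>Adding 1 to the norm covers v = 0.\<close>
    then obtain k where k: "2 / real (Suc k) / r < \<epsilon> / (norm v + 1)"
      using small[of "\<epsilon> / (norm v + 1)"] by (metis divide_pos_pos add_nonneg_pos norm_ge_zero zero_less_one)
    have "2 / real (Suc k) / r * norm v \<le> 2 / real (Suc k) / r * (norm v + 1)"
      using r by (intro mult_left_mono) auto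
    also have "\<dots> < \<epsilon>"
      using k by (subst (asm) pos_less_divide_eq) (auto intro: add_nonneg_pos)
    finally show "\<exists>M. \<forall>m\<ge>M. \<forall>n\<ge>M. dist (D m x v) (D n x v) < \<epsilon>"
      using cauchy[OF x, of k] unfolding dist_norm by (meson le_less_trans)
  qed
  then have "\<forall>x v. \<exists>l. x \<in> ball a r \<longrightarrow> (\<lambda>n. D n x v) \<longlonglongrightarrow> l"
    unfolding convergent_def by blast
  then obtain E where E: "\<And>x v. x \<in> ball a r \<Longrightarrow> (\<lambda>n. D n x v) \<longlonglongrightarrow> E x v"
    by metis
  have DE: "cmod (D n x v - E x v) \<le> 2 / real (Suc k) / r * norm v"
    if x: "x \<in> ball a r" and nm: "n \<ge> k" for x v n k
  proof (rule tendsto_upperbound)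
    show "(\<lambda>m. cmod (D n x v - D m x v)) \<longlonglongrightarrow> cmod (D n x v - E x v)"
      by (intro tendsto_intros E x)
    show "\<forall>\<^sub>F m in sequentially. cmod (D n x v - D m x v) \<le> 2 / real (Suc k) / r * norm v"
      using cauchy[OF x nm] unfolding eventually_sequentially by blast
  qed simp
  have hlim: "(\<lambda>n. h n x) \<longlonglongrightarrow> g x" if "x \<in> cball a e" for x
  proof (rule tendstoI)
    fix \<epsilon> :: real assume "\<epsilon> > 0"
    have "(\<lambda>n. 1 / real (Suc n)) \<longlonglongrightarrow> 0" by real_asymp
    then have "\<forall>\<^sub>F n in sequentially. 1 / real (Suc n) < \<epsilon>"
      using \<open>\<epsilon> > 0\<close> by (rule order_tendstoD)
    then show "\<forall>\<^sub>F n in sequentially. dist (h n x) (g x) < \<epsilon>"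
      by eventually_elim (use hg[OF that] in \<open>force intro: less_trans\<close>)
  qed
  have ar: "a \<in> ball a r" and ae: "a \<in> cball a e" using r e by auto
  have "\<exists>g'. \<forall>x\<in>ball a r. (\<lambda>n. h n x) \<longlonglongrightarrow> g' x \<and> (g' has_derivative E x) (at x within ball a r)"
  proof (rule has_derivative_sequence[where S = "ball a r" and f = h and f' = D and g' = E
        and ?x0.0 = a and l = "g a"])
    show "(h n has_derivative D n x) (at x within ball a r)" if "x \<in> ball a r" for n x
      by (rule has_derivative_at_withinI[OF D(1)[OF subX[OF that]]])
    fix \<epsilon> :: real assume "\<epsilon> > 0"
    then obtain k where k: "2 / real (Suc k) / r < \<epsilon>" using small by blast
    have "cmod (D n x v - E x v) \<le> \<epsilon> * norm v" if "n \<ge> k" "x \<in> ball a r" for n x v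
      by (rule order_trans[OF DE[OF that(2,1)] mult_right_mono[OF less_imp_le[OF k] norm_ge_zero]])
    then show "\<forall>\<^sub>F n in sequentially. \<forall>x\<in>ball a r. \<forall>v. norm (D n x v - E x v) \<le> \<epsilon> * norm v"
      unfolding eventually_sequentially by blast
  qed (simp_all add: r hlim[OF ae])
  then obtain g' where g': "\<And>x. x \<in> ball a r \<Longrightarrow> (\<lambda>n. h n x) \<longlonglongrightarrow> g' x"
      "\<And>x. x \<in> ball a r \<Longrightarrow> (g' has_derivative E x) (at x within ball a r)"
    by blast
  have eq: "g' x = g x" if "x \<in> ball a r" for x
    by (rule LIMSEQ_unique[OF g'(1)[OF that] hlim[OF subE[OF that]]])
  have "(g has_derivative E a) (at a within ball a r)"
    by (rule has_derivative_transform[OF ar _ g'(2)[OF ar]]) (simp add: eq)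
  then have "(g has_derivative E a) (at a)"
    using ar by (simp add: at_within_open[of _ "ball a r"])
  moreover have "E a (c *s v) = c * E a v" for c v
  proof (rule LIMSEQ_unique[OF E[OF ar]])
    show "(\<lambda>n. D n a (c *s v)) \<longlonglongrightarrow> c * E a v"
      unfolding D(2)[OF a] by (intro tendsto_intros E ar)
  qed
  ultimately show "\<exists>D. (g has_derivative D) (at a) \<and> (\<forall>c v. D (c *s v) = c * D v)" by blast
qed

text \<open>\<open>C\<close> is covered by finitely many closed balls on whose traces g varies by
  less than \<epsilon>/2. Each trace is compact, so mapping it into the ball of radius \<epsilon>/2
  about \<open>g c\<close> is a subbasic open condition, met eventually.\<close>

lemma limitin_compact_open_imp_uniform_limit:
  fixes f :: "'i \<Rightarrow> 'a::metric_space \<Rightarrow> 'b::metric_space"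
  assumes lim: "limitin (compact_open_topology S) f g F" and C: "compact C" "C \<subseteq> S"
  shows "uniform_limit C f g F"
proof (rule uniform_limitI)
  fix \<epsilon> :: real assume \<epsilon>: "\<epsilon> > 0"
  have g: "continuous_on S g"
    using limitin_topspace[OF lim] by (simp add: topspace_compact_open_topology)
  have ev: "\<forall>\<^sub>F i in F. f i ` K \<subseteq> U" if "compact K" "K \<subseteq> S" "open U" "g ` K \<subseteq> U" for K U
  proof -
    have "openin (compact_open_topology S) {f. continuous_on S f \<and> f ` K \<subseteq> U}"
      unfolding compact_open_topology_def using that
      by (intro topology_generated_by_Basis) blast
    then have "\<forall>\<^sub>F i in F. f i \<in> {f. continuous_on S f \<and> f ` K \<subseteq> U}"
      using lim that g unfolding limitin_def by blast
    then show ?thesis by eventually_elim simp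
  qed
  have "\<exists>d>0. \<forall>y\<in>C \<inter> cball c d. dist (g y) (g c) < \<epsilon> / 2" if "c \<in> C" for c
  proof -
    have "continuous_on C g" by (rule continuous_on_subset[OF g C(2)])
    from this[unfolded continuous_on_iff, rule_format, OF that half_gt_zero[OF \<epsilon>]]
    obtain d where "d > 0" "\<And>y. y \<in> C \<Longrightarrow> dist y c < d \<Longrightarrow> dist (g y) (g c) < \<epsilon> / 2"
      by blast
    then show ?thesis by (intro exI[of _ "d / 2"]) (auto simp: dist_commute)
  qed
  then obtain d where d: "\<And>c. c \<in> C \<Longrightarrow> d c > 0"
      "\<And>c y. c \<in> C \<Longrightarrow> y \<in> C \<inter> cball c (d c) \<Longrightarrow> dist (g y) (g c) < \<epsilon> / 2"
    by metis
  have "C \<subseteq> (\<Union>c\<in>C. ball c (d c))" using d(1) by fastforce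
  then obtain T where T: "T \<subseteq> C" "finite T" "C \<subseteq> (\<Union>c\<in>T. ball c (d c))"
    using compactE_image[OF C(1), of C "\<lambda>c. ball c (d c)"] by auto
  have "\<forall>\<^sub>F i in F. f i ` (C \<inter> cball c (d c)) \<subseteq> ball (g c) (\<epsilon> / 2)" if "c \<in> T" for c
  proof (rule ev)
    show "compact (C \<inter> cball c (d c))" using C by (intro compact_Int_closed) auto
    show "g ` (C \<inter> cball c (d c)) \<subseteq> ball (g c) (\<epsilon> / 2)"
      using d(2)[of c] that T by (force simp: dist_commute)
  qed (use C in auto)
  then have "\<forall>\<^sub>F i in F. \<forall>c\<in>T. f i ` (C \<inter> cball c (d c)) \<subseteq> ball (g c) (\<epsilon> / 2)"
    using T(2) by (simp add: eventually_ball_finite)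
  then show "\<forall>\<^sub>F i in F. \<forall>x\<in>C. dist (f i x) (g x) < \<epsilon>"
  proof eventually_elim
    case (elim i)
    show ?case
    proof
      fix x assume x: "x \<in> C"
      then obtain c where c: "c \<in> T" "x \<in> C \<inter> cball c (d c)" using T(3) by fastforce
      have "f i x \<in> f i ` (C \<inter> cball c (d c))" using c(2) by (rule imageI)
      then have "f i x \<in> ball (g c) (\<epsilon> / 2)" using elim c(1) by blast
      moreover have "dist (g x) (g c) < \<epsilon> / 2"
        by (rule d(2)[OF subsetD[OF T(1) c(1)] c(2)])
      ultimately show "dist (f i x) (g x) < \<epsilon>"
        using dist_triangle[of "f i x" "g x" "g c"] by (simp add: dist_commute)
    qed
  qed
qed

section \<open>Positive semi-definite kernels\<close>

lemma psd_matrix_two_indices: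
  assumes A: "psd_matrix m A" and ij: "i < m" "j < m"
  shows "cnj \<alpha> * A i i * \<alpha> + cnj \<alpha> * A i j * \<beta> + cnj \<beta> * A j i * \<alpha> + cnj \<beta> * A j j * \<beta> \<in> \<real>"
    and "Re (cnj \<alpha> * A i i * \<alpha> + cnj \<alpha> * A i j * \<beta> + cnj \<beta> * A j i * \<alpha> + cnj \<beta> * A j j * \<beta>) \<ge> 0"
proof -
  \<comment> \<open>A sum of two indicator vectors, so that i = j is covered as well; the diagonal
    entries are obtained in this way.\<close>
  define c where "c k = (if k = i then \<alpha> else 0) + (if k = j then \<beta> else 0)" for k
  have r: "(\<Sum>l<m. g l * c l) = g i * \<alpha> + g j * \<beta>" for g
    using ij by (simp add: c_def distrib_left sum.distrib if_distrib[of "(*) _"] cong: if_cong)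
  have l: "(\<Sum>l<m. cnj (c l) * g l) = cnj \<alpha> * g i + cnj \<beta> * g j" for g
  proof -
    have "(\<Sum>l<m. cnj (c l) * g l) = cnj (\<Sum>l<m. cnj (g l) * c l)"
      by (simp add: mult.commute)
    then show ?thesis unfolding r by (simp add: mult.commute)
  qed
  have "(\<Sum>k<m. \<Sum>l<m. cnj (c k) * A k l * c l) = (\<Sum>k<m. cnj (c k) * (A k i * \<alpha> + A k j * \<beta>))"
    unfolding r[symmetric] by (simp add: sum_distrib_left mult.assoc)
  also have "\<dots> = cnj \<alpha> * A i i * \<alpha> + cnj \<alpha> * A i j * \<beta> + cnj \<beta> * A j i * \<alpha> + cnj \<beta> * A j j * \<beta>"
    unfolding l by (simp add: algebra_simps)
  finally have eq: "(\<Sum>k<m. \<Sum>l<m. cnj (c k) * A k l * c l) = \<dots>" .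
  have "(\<Sum>k<m. \<Sum>l<m. cnj (c k) * A k l * c l) \<in> \<real>"
    "Re (\<Sum>k<m. \<Sum>l<m. cnj (c k) * A k l * c l) \<ge> 0"
    using A unfolding psd_matrix_def by blast+
  then show "cnj \<alpha> * A i i * \<alpha> + cnj \<alpha> * A i j * \<beta> + cnj \<beta> * A j i * \<alpha> + cnj \<beta> * A j j * \<beta> \<in> \<real>"
    "Re (cnj \<alpha> * A i i * \<alpha> + cnj \<alpha> * A i j * \<beta> + cnj \<beta> * A j i * \<alpha> + cnj \<beta> * A j j * \<beta>) \<ge> 0"
    unfolding eq by auto
qed

lemma psd_matrix_diagonal:
  assumes "psd_matrix m A" "i < m"
  shows "A i i = of_real (Re (A i i))" "Re (A i i) \<ge> 0"
  using psd_matrix_two_indices[OF assms(1) assms(2) assms(2), of 1 0] by auto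

lemma psd_matrix_hermitian:
  assumes "psd_matrix m A" "i < m" "j < m"
  shows "A j i = cnj (A i j)"
proof (rule complex_eqI)
  have "Im (A i i) = 0" "Im (A j j) = 0"
    using psd_matrix_diagonal(1)[OF assms(1)] assms by (metis Im_complex_of_real)+
  \<comment> \<open>Polarisation: at (1, 1) the form being real makes \<open>A i j + A j i\<close>
    real, and at (1, \<i>) it makes \<open>\<i> * (A i j - A j i)\<close> real.\<close>
  then show "Re (A j i) = Re (cnj (A i j))" "Im (A j i) = Im (cnj (A i j))"
    using psd_matrix_two_indices(1)[OF assms, of 1 1] psd_matrix_two_indices(1)[OF assms, of 1 \<i>]
    by (auto simp: complex_is_Real_iff)
qed

lemma psd_matrix_zero_diagonal:
  assumes A: "psd_matrix m A" and ij: "i < m" "j < m" and 0: "A j j = 0"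
  shows "A i j = 0"
proof (rule ccontr)
  assume ne: "A i j \<noteq> 0"
  \<comment> \<open>Without a quadratic term in the second coordinate the form is unbounded below.
    This \<open>n\<close> gives it the value \<open>- Re (A i i) - 2\<close> at the vector with
    entries 1 and \<open>?\<beta>\<close>.\<close>
  define n where "n = (Re (A i i) + 1) / (cmod (A i j))\<^sup>2"
  have n: "n * (cmod (A i j))\<^sup>2 = Re (A i i) + 1" using ne by (simp add: n_def)
  let ?\<beta> = "- of_real n * cnj (A i j)"
  have t1: "A i j * ?\<beta> = - of_real (Re (A i i) + 1)"
    unfolding n[symmetric] by (simp add: complex_norm_square del: of_real_power)
  have t2: "cnj ?\<beta> * A j i = - of_real (Re (A i i) + 1)"
    unfolding n[symmetric] psd_matrix_hermitian[OF A ij]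
    by (simp add: complex_norm_square del: of_real_power)
  have "cnj 1 * A i i * 1 + cnj 1 * A i j * ?\<beta> + cnj ?\<beta> * A j i * 1 + cnj ?\<beta> * A j j * ?\<beta>
      = A i i + A i j * ?\<beta> + cnj ?\<beta> * A j i"
    by (simp only: 0 complex_cnj_one mult_1_left mult_1_right mult_zero_right mult_zero_left add_0_right)
  then have "Re (A i i + A i j * ?\<beta> + cnj ?\<beta> * A j i) \<ge> 0"
    using psd_matrix_two_indices(2)[OF A ij, of 1 ?\<beta>] by (simp only:)
  then have "Re (A i i) - 2 * (Re (A i i) + 1) \<ge> 0"
    unfolding t1 t2 by simp
  then show False using psd_matrix_diagonal(2)[OF A ij(1)] by simp
qed

text \<open>Symmetric elimination: subtract the rank one matrix made of the last column (it is zero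
  if the last diagonal entry \<open>a\<close> is zero, and then so are the quotients by \<open>a\<close>).\<close>

lemma psd_matrix_gram:
  assumes "psd_matrix m A"
  shows "\<exists>V :: nat \<Rightarrow> nat \<Rightarrow> complex. \<forall>i<m. \<forall>j<m. A i j = (\<Sum>k<m. V k i * cnj (V k j))"
  using assms
proof (induction m arbitrary: A)
  case 0
  then show ?case by simp
next
  case (Suc m)
  define a where "a = Re (A m m)"
  have a: "A m m = of_real a" "a \<ge> 0"
    using psd_matrix_diagonal[OF Suc.prems, of m] by (auto simp: a_def)
  have herm: "A j i = cnj (A i j)" if "i < Suc m" "j < Suc m" for i j
    using psd_matrix_hermitian[OF Suc.prems that] .
  have zero: "A i m = 0" if "a = 0" "i < Suc m" for i
    using psd_matrix_zero_diagonal[OF Suc.prems that(2), of m] that(1) a by simp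
  have zero': "A m i = 0" if "a = 0" "i < Suc m" for i
    using herm[of i m] zero[OF that] that by simp
  define B where "B i j = A i j - A i m * A m j / of_real a" for i j
  have "psd_matrix m B"
    unfolding psd_matrix_def
  proof
    fix c :: "nat \<Rightarrow> complex"
    define s where "s = (\<Sum>j<m. A m j * c j)"
    \<comment> \<open>Completing the square: this last coordinate makes the form of \<open>A\<close>
      at \<open>c'\<close> equal to that of the Schur complement \<open>B\<close> at
      \<open>c\<close>. For a = 0 the quotient is 0 by convention, and s vanishes too.\<close>
    define c' where "c' i = (if i < m then c i else - s / of_real a)" for i
    have c': "\<And>i. i < m \<Longrightarrow> c' i = c i" "c' m = - s / of_real a" by (auto simp: c'_def)
    have s: "(\<Sum>i<m. cnj (c i) * A i m) = cnj s"
      unfolding s_def by (simp add: herm[of _ m] mult.commute)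
    have s0: "s = 0" if "a = 0" unfolding s_def using zero'[OF that] by simp
    have "(\<Sum>i<Suc m. \<Sum>j<Suc m. cnj (c' i) * A i j * c' j)
        = (\<Sum>i<m. (\<Sum>j<m. cnj (c i) * A i j * c j) + cnj (c i) * A i m * c' m)
          + ((\<Sum>j<m. cnj (c' m) * A m j * c j) + cnj (c' m) * A m m * c' m)"
      by (simp add: c'(1))
    also have "\<dots> = (\<Sum>i<m. \<Sum>j<m. cnj (c i) * A i j * c j) + (\<Sum>i<m. cnj (c i) * A i m) * c' m
          + (cnj (c' m) * (\<Sum>j<m. A m j * c j) + cnj (c' m) * A m m * c' m)"
      by (simp add: sum.distrib sum_distrib_left sum_distrib_right mult.assoc)
    also have "\<dots> = (\<Sum>i<m. \<Sum>j<m. cnj (c i) * A i j * c j) - cnj s * s / of_real a"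
      unfolding s s_def[symmetric] c'(2) a using s0 by (cases "a = 0") (auto simp: field_simps)
    also have "\<dots> = (\<Sum>i<m. \<Sum>j<m. cnj (c i) * B i j * c j)"
    proof -
      have "cnj s * s / of_real a = (\<Sum>i<m. \<Sum>j<m. cnj (c i) * (A i m * A m j / of_real a) * c j)"
      proof -
        have "cnj s * s = (\<Sum>i<m. cnj (c i) * A i m) * (\<Sum>j<m. A m j * c j)"
          unfolding s by (simp add: s_def)
        then show ?thesis by (simp add: sum_product sum_divide_distrib mult.assoc)
      qed
      then show ?thesis
        by (simp add: B_def right_diff_distrib left_diff_distrib sum_subtractf)
    qed
    finally have eq: "(\<Sum>i<Suc m. \<Sum>j<Suc m. cnj (c' i) * A i j * c' j)
        = (\<Sum>i<m. \<Sum>j<m. cnj (c i) * B i j * c j)" .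
    show "(\<Sum>i<m. \<Sum>j<m. cnj (c i) * B i j * c j) \<in> \<real> \<and>
        0 \<le> Re (\<Sum>i<m. \<Sum>j<m. cnj (c i) * B i j * c j)"
      unfolding eq[symmetric] by (rule Suc.prems[unfolded psd_matrix_def, rule_format])
  qed
  from Suc.IH[OF this] obtain V where
    V: "\<And>i j. i < m \<Longrightarrow> j < m \<Longrightarrow> B i j = (\<Sum>k<m. V k i * cnj (V k j))" by blast
  \<comment> \<open>The factor of \<open>B\<close>, padded by zeros, together with one further row
    that contributes exactly the rank one matrix subtracted from \<open>A\<close>.\<close>
  define W where "W k i = (if k < m then if i < m then V k i else 0 else A i m / of_real (sqrt a))" for k i
  have sq: "of_real (sqrt a) * of_real (sqrt a) = (of_real a :: complex)"
    using a by (simp flip: of_real_mult)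
  have W: "(\<Sum>k<Suc m. W k i * cnj (W k j))
      = (\<Sum>k<m. (if i < m \<and> j < m then V k i * cnj (V k j) else 0)) + A i m * A m j / of_real a"
    if "j < Suc m" for i j
    using herm[OF that, of m] sq by (simp add: W_def if_distrib cong: if_cong)
  have "A i j = (\<Sum>k<Suc m. W k i * cnj (W k j))" if ij: "i < Suc m" "j < Suc m" for i j
  proof (cases "i < m \<and> j < m")
    case True
    then show ?thesis unfolding W[OF ij(2)] using V by (simp add: B_def flip: V)
  next
    case False
    then consider "i = m" | "j = m" using ij by linarith
    then show ?thesis
    proof cases
      case 1
      then show ?thesis unfolding W[OF ij(2)] using zero'[OF _ ij(2)] a by (cases "a = 0") auto
    next
      case 2
      then show ?thesis unfolding W[OF ij(2)] using zero[OF _ ij(1)] a by (cases "a = 0") auto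
    qed
  qed
  then show ?case by blast
qed

text \<open>Inserting a Gram factorisation \<open>V\<close> of \<open>A\<close> turns the form of
  the product at \<open>c\<close> into a sum over k of forms of \<open>B\<close> at the vectors
  \<open>c j * cnj (V k j)\<close>.\<close>

theorem schur_product_psd:
  assumes A: "psd_matrix m A" and B: "psd_matrix m B"
  shows "psd_matrix m (\<lambda>i j. A i j * B i j)"
  unfolding psd_matrix_def
proof
  fix c :: "nat \<Rightarrow> complex"
  obtain V where V: "\<And>i j. i < m \<Longrightarrow> j < m \<Longrightarrow> A i j = (\<Sum>k<m. V k i * cnj (V k j))"
    using psd_matrix_gram[OF A] by blast
  let ?S = "\<lambda>k. \<Sum>i<m. \<Sum>j<m. cnj (c i * cnj (V k i)) * B i j * (c j * cnj (V k j))"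
  have "(\<Sum>i<m. \<Sum>j<m. cnj (c i) * (A i j * B i j) * c j)
      = (\<Sum>i<m. \<Sum>j<m. \<Sum>k<m. cnj (c i * cnj (V k i)) * B i j * (c j * cnj (V k j)))"
    by (intro sum.cong refl) (simp add: V sum_distrib_left sum_distrib_right mult_ac)
  also have "\<dots> = (\<Sum>i<m. \<Sum>k<m. \<Sum>j<m. cnj (c i * cnj (V k i)) * B i j * (c j * cnj (V k j)))"
    by (intro sum.cong refl sum.swap)
  also have "\<dots> = (\<Sum>k<m. ?S k)" by (rule sum.swap)
  finally have eq: "(\<Sum>i<m. \<Sum>j<m. cnj (c i) * (A i j * B i j) * c j) = (\<Sum>k<m. ?S k)" .
  have S: "?S k \<in> \<real> \<and> Re (?S k) \<ge> 0" for k
    by (rule B[unfolded psd_matrix_def, rule_format])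
  have "(\<Sum>k<m. ?S k) \<in> \<real>" by (rule sum_in_Reals) (rule conjunct1[OF S])
  moreover have "Re (\<Sum>k<m. ?S k) \<ge> 0"
    unfolding Re_sum[of ?S "{..<m}"] by (rule sum_nonneg) (rule conjunct2[OF S])
  ultimately show "(\<Sum>i<m. \<Sum>j<m. cnj (c i) * (A i j * B i j) * c j) \<in> \<real> \<and>
      0 \<le> Re (\<Sum>i<m. \<Sum>j<m. cnj (c i) * (A i j * B i j) * c j)"
    unfolding eq by (rule conjI)
qed

section \<open>From matrices to kernels\<close>

lemma psd_kernel_mult:
  "psd_kernel X K \<Longrightarrow> psd_kernel X L \<Longrightarrow> psd_kernel X (\<lambda>x y. K x y * L x y)"
  unfolding psd_kernel_def by (simp add: schur_product_psd)

lemma psd_kernel_hermitian: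
  assumes "psd_kernel X L" "x \<in> X" "y \<in> X"
  shows "L y x = cnj (L x y)"
proof -
  let ?x = "\<lambda>i::nat. if i = 0 then x else y"
  have "psd_matrix 2 (\<lambda>i j. L (?x i) (?x j))"
    using assms unfolding psd_kernel_def by simp
  from psd_matrix_hermitian[OF this, of 0 1] show ?thesis by simp
qed

lemma psd_kernel_rescale:
  assumes L: "psd_kernel X L" and M: "\<And>x y. x \<in> X \<Longrightarrow> y \<in> X \<Longrightarrow> M x y = \<omega> x * cnj (\<omega> y) * L x y"
  shows "psd_kernel X M"
  unfolding psd_kernel_def psd_matrix_def
proof (intro allI impI)
  fix m :: nat and x :: "nat \<Rightarrow> 'a" and c :: "nat \<Rightarrow> complex"
  assume x: "\<forall>i<m. x i \<in> X"
  \<comment> \<open>The factors of the rescaling are absorbed into the test vector.\<close>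
  let ?c = "\<lambda>i. cnj (\<omega> (x i)) * c i"
  have "(\<Sum>i<m. \<Sum>j<m. cnj (c i) * M (x i) (x j) * c j)
      = (\<Sum>i<m. \<Sum>j<m. cnj (?c i) * L (x i) (x j) * ?c j)"
    using x by (intro sum.cong refl) (simp add: M mult_ac)
  then show "(\<Sum>i<m. \<Sum>j<m. cnj (c i) * M (x i) (x j) * c j) \<in> \<real> \<and>
      0 \<le> Re (\<Sum>i<m. \<Sum>j<m. cnj (c i) * M (x i) (x j) * c j)"
    using L[unfolded psd_kernel_def psd_matrix_def, rule_format, of m x ?c] x by simp
qed

lemma psd_kernel_limit:
  fixes X :: "'a set" and K :: "'i \<Rightarrow> 'a \<Rightarrow> 'a \<Rightarrow> complex"
  assumes F: "F \<noteq> bot" and K: "\<forall>\<^sub>F i in F. psd_kernel X (K i)"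
    and lim: "\<And>x y. x \<in> X \<Longrightarrow> y \<in> X \<Longrightarrow> ((\<lambda>i. K i x y) \<longlongrightarrow> L x y) F"
  shows "psd_kernel X L"
  unfolding psd_kernel_def psd_matrix_def
proof (intro allI impI)
  fix m :: nat and x :: "nat \<Rightarrow> 'a" and c :: "nat \<Rightarrow> complex"
  assume x: "\<forall>i<m. x i \<in> X"
  let ?Q = "\<lambda>K. \<Sum>i<m. \<Sum>j<m. cnj (c i) * K (x i) (x j) * c j"
  have "?Q L \<in> \<real> \<inter> {z. 0 \<le> Re z}"
  proof (rule Lim_in_closed_set[OF _ _ F])
    show "closed (\<real> \<inter> {z. 0 \<le> Re z})"
      by (intro closed_Int closed_complex_Reals closed_Collect_le continuous_intros)
    show "((\<lambda>i. ?Q (K i)) \<longlongrightarrow> ?Q L) F"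
      using x by (intro tendsto_intros lim) auto
    show "\<forall>\<^sub>F i in F. ?Q (K i) \<in> \<real> \<inter> {z. 0 \<le> Re z}"
      using K by eventually_elim (use x in \<open>auto simp: psd_kernel_def psd_matrix_def\<close>)
  qed
  then show "?Q L \<in> \<real> \<and> 0 \<le> Re (?Q L)" by simp
qed

section \<open>Projective invariance\<close>

lemma sesqui_holomorphicD:
  assumes "sesqui_holomorphic X L"
  shows "y \<in> X \<Longrightarrow> holomorphic_fun_on (\<lambda>x. L x y) X"
    and "x \<in> X \<Longrightarrow> holomorphic_fun_on (\<lambda>y. cnj (L x y)) X"
  using assms unfolding sesqui_holomorphic_def antiholomorphic_fun_on_def by auto

lemma sesqui_holomorphic_const: "sesqui_holomorphic X (\<lambda>x y. c)"
  unfolding sesqui_holomorphic_def antiholomorphic_fun_on_def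
  by (simp add: holomorphic_fun_on_const)

lemma sesqui_holomorphic_mult:
  assumes "sesqui_holomorphic X K" "sesqui_holomorphic X L"
  shows "sesqui_holomorphic X (\<lambda>x y. K x y * L x y)"
  using assms unfolding sesqui_holomorphic_def antiholomorphic_fun_on_def
  by (simp add: holomorphic_fun_on_mult)

lemma sesqui_holomorphic_diff:
  assumes "sesqui_holomorphic X K" "sesqui_holomorphic X L"
  shows "sesqui_holomorphic X (\<lambda>x y. K x y - L x y)"
  using assms unfolding sesqui_holomorphic_def antiholomorphic_fun_on_def
  by (simp add: holomorphic_fun_on_diff)

lemma sesqui_holomorphic_rank_one:
  "holomorphic_fun_on w X \<Longrightarrow> sesqui_holomorphic X (\<lambda>x y. w x * cnj (w y))"
  unfolding sesqui_holomorphic_def antiholomorphic_fun_on_def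
  by (simp add: holomorphic_fun_on_mult holomorphic_fun_on_const)

lemma Aut_mem: "\<Phi> \<in> Aut X \<Longrightarrow> x \<in> X \<Longrightarrow> \<Phi> x \<in> X"
  unfolding Aut_def by (auto simp: bij_betw_def)

lemma sesqui_holomorphic_compose:
  assumes L: "sesqui_holomorphic X L" and \<Phi>: "\<Phi> \<in> Aut X"
  shows "sesqui_holomorphic X (\<lambda>x y. L (\<Phi> x) (\<Phi> y))"
proof -
  have h: "holomorphic_map_on \<Phi> X" "\<Phi> ` X \<subseteq> X"
    using \<Phi> Aut_mem[OF \<Phi>] unfolding Aut_def by auto
  show ?thesis
    unfolding sesqui_holomorphic_def antiholomorphic_fun_on_def
  proof (intro conjI ballI)
    show "holomorphic_fun_on (\<lambda>x. L (\<Phi> x) (\<Phi> y)) X" if "y \<in> X" for y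
      by (rule holomorphic_fun_on_compose[OF sesqui_holomorphicD(1)[OF L Aut_mem[OF \<Phi> that]] h])
    show "holomorphic_fun_on (\<lambda>y. cnj (L (\<Phi> x) (\<Phi> y))) X" if "x \<in> X" for x
      by (rule holomorphic_fun_on_compose[OF sesqui_holomorphicD(2)[OF L Aut_mem[OF \<Phi> that]] h])
  qed
qed

section \<open>Cross ratios and rescalings\<close>

lemma nondegenerate_nonzero: "nondegenerate X L \<Longrightarrow> x \<in> X \<Longrightarrow> L x x \<noteq> 0"
  unfolding nondegenerate_def by force

text \<open>Stated without division, because a kernel may vanish off the diagonal.\<close>

definition same_cross_ratios ::
  "'a set \<Rightarrow> ('a \<Rightarrow> 'a \<Rightarrow> complex) \<Rightarrow> ('a \<Rightarrow> 'a \<Rightarrow> complex) \<Rightarrow> bool" where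
  "same_cross_ratios X A B \<longleftrightarrow> (\<forall>x\<in>X. \<forall>y\<in>X. \<forall>z\<in>X. \<forall>w\<in>X.
     A x y * A z w * (B x w * B z y) = A x w * A z y * (B x y * B z w))"

text \<open>Each of x, y, z, w contributes its factor once to either side. The constant
  \<open>c\<close> leaves room for a positive number that the local power of a factor does not
  contain.\<close>

lemma same_cross_ratios_rescale:
  assumes "\<And>x y. x \<in> X \<Longrightarrow> y \<in> X \<Longrightarrow> A x y = c * (\<omega> x * cnj (\<omega> y)) * B x y"
  shows "same_cross_ratios X A B"
  unfolding same_cross_ratios_def by (simp add: assms mult_ac)

text \<open>The difference of the two sides is holomorphic in x and z and antiholomorphic in y and
  w. The identity theorem therefore releases the variables from \<open>V\<close> to \<open>X\<close>
  one at a time, after conjugation for y and w.\<close>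

lemma same_cross_ratios_extend:
  fixes A B :: "complex ^ 'n \<Rightarrow> complex ^ 'n \<Rightarrow> complex"
  assumes X: "open X" "connected X" and V: "open V" "V \<noteq> {}" "V \<subseteq> X"
    and A: "sesqui_holomorphic X A" and B: "sesqui_holomorphic X B"
    and cr: "same_cross_ratios V A B"
  shows "same_cross_ratios X A B"
proof -
  define E where "E x y z w = A x y * A z w * (B x w * B z y) - A x w * A z y * (B x y * B z w)" for x y z w
  note hol = holomorphic_fun_on_diff holomorphic_fun_on_mult holomorphic_fun_on_const
    sesqui_holomorphicD[OF A] sesqui_holomorphicD[OF B]
  have h: "holomorphic_fun_on (\<lambda>x. E x y z w) X" "holomorphic_fun_on (\<lambda>z. E x y z w) X"
    "holomorphic_fun_on (\<lambda>y. cnj (E x y z w)) X" "holomorphic_fun_on (\<lambda>w. cnj (E x y z w)) X"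
    if "x \<in> X" "y \<in> X" "z \<in> X" "w \<in> X" for x y z w
    unfolding E_def complex_cnj_diff complex_cnj_mult by (intro hol that)+
  note ext = holomorphic_fun_on_eq_zero[OF _ X V]
  note VX = subsetD[OF V(3)]
  obtain v where v: "v \<in> V" using V(2) by blast
  have 0: "E x y z w = 0" if "x \<in> V" "y \<in> V" "z \<in> V" "w \<in> V" for x y z w
    using cr that unfolding same_cross_ratios_def E_def by simp
  have 1: "E x y z w = 0" if "x \<in> X" "y \<in> V" "z \<in> V" "w \<in> V" for x y z w
    by (rule ext[of "\<lambda>x. E x y z w"]) (use that h(1) 0 VX in auto)
  have "cnj (E x y z w) = 0" if "x \<in> X" "y \<in> X" "z \<in> V" "w \<in> V" for x y z w
    by (rule ext[of "\<lambda>y. cnj (E x y z w)"]) (use that h(3) 1 VX in auto)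
  then have 2: "E x y z w = 0" if "x \<in> X" "y \<in> X" "z \<in> V" "w \<in> V" for x y z w
    using that by simp
  have 3: "E x y z w = 0" if "x \<in> X" "y \<in> X" "z \<in> X" "w \<in> V" for x y z w
    by (rule ext[of "\<lambda>z. E x y z w"]) (use that h(2) 2 VX in auto)
  have "cnj (E x y z w) = 0" if "x \<in> X" "y \<in> X" "z \<in> X" "w \<in> X" for x y z w
    by (rule ext[of "\<lambda>w. cnj (E x y z w)"]) (use that h(4) 3 VX in auto)
  then have "E x y z w = 0" if "x \<in> X" "y \<in> X" "z \<in> X" "w \<in> X" for x y z w
    using that by simp
  then show ?thesis unfolding same_cross_ratios_def E_def by simp
qed

text \<open>With \<open>R x = A x z / B x z\<close>, the cross ratio of \<open>x, z\<close> and \<open>y, z\<close> gives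
  \<open>A x y = R x * cnj (R y) * (B z z / A z z) * B x y\<close> for every \<open>z\<close> at which no denominator
  vanishes; the quotients \<open>R x / R z0\<close> do not depend on the choice of such a \<open>z\<close>.\<close>

lemma rescaling_of_same_cross_ratios:
  fixes A B :: "complex ^ 'n \<Rightarrow> complex ^ 'n \<Rightarrow> complex"
  assumes X: "open X" "connected X"
    and A: "sesqui_holomorphic X A" "nondegenerate X A" "psd_kernel X A"
    and B: "sesqui_holomorphic X B" "nondegenerate X B" "psd_kernel X B"
    and "same_cross_ratios X A B"
  shows "rescaling X A B"
proof (cases "X = {}")
  case True
  then show ?thesis using A B by (simp add: rescaling_def)
next
  case False
  then obtain z0 where z0: "z0 \<in> X" by blast
  note herm = psd_kernel_hermitian[OF A(3)] psd_kernel_hermitian[OF B(3)]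
  note nz = nondegenerate_nonzero[OF A(2)] nondegenerate_nonzero[OF B(2)]
  have cr: "A x y * A z w * (B x w * B z y) = A x w * A z y * (B x y * B z w)"
    if "x \<in> X" "y \<in> X" "z \<in> X" "w \<in> X" for x y z w
    using assms(9) that unfolding same_cross_ratios_def by blast
  have generic: "\<exists>z\<in>X. \<forall>x\<in>S. A x z \<noteq> 0 \<and> B x z \<noteq> 0" if S: "finite S" "S \<subseteq> X" for S
  proof -
    have "\<exists>z\<in>X. \<forall>x\<in>S. A z x * B z x \<noteq> 0"
    proof (rule common_nonzero_point[OF X False S(1)])
      show "holomorphic_fun_on (\<lambda>z. A z x * B z x) X" if "x \<in> S" for x
        using that S by (intro holomorphic_fun_on_mult sesqui_holomorphicD A B) auto
      show "\<exists>z\<in>X. A z x * B z x \<noteq> 0" if "x \<in> S" for x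
        using that S nz by (intro bexI[of _ x]) auto
    qed
    then obtain z where z: "z \<in> X" "\<forall>x\<in>S. A z x * B z x \<noteq> 0" by blast
    have "A x z \<noteq> 0 \<and> B x z \<noteq> 0" if "x \<in> S" for x
      using z herm[OF z(1), of x] S(2) that by auto
    then show ?thesis using z(1) by blast
  qed
  \<comment> \<open>The normalisation at \<open>z0\<close>: the factor takes the value
    \<open>sqrt \<rho>\<close> there, a real root because both kernels are positive on the
    diagonal.\<close>
  define \<rho> where "\<rho> = Re (A z0 z0) / Re (B z0 z0)"
  have real: "A x x = of_real (Re (A x x))" "Re (A x x) > 0"
    "B x x = of_real (Re (B x x))" "Re (B x x) > 0" if "x \<in> X" for x
    using A(2) B(2) that unfolding nondegenerate_def by auto
  have \<rho>: "\<rho> > 0" "of_real \<rho> * B z0 z0 = A z0 z0"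
  proof -
    show "\<rho> > 0" using real[OF z0] by (simp add: \<rho>_def)
    have "of_real \<rho> * B z0 z0 = of_real (\<rho> * Re (B z0 z0))"
      by (subst real(3)[OF z0]) simp
    also have "\<dots> = A z0 z0"
      using real[OF z0] by (simp add: \<rho>_def)
    finally show "of_real \<rho> * B z0 z0 = A z0 z0" .
  qed
  let ?q = "of_real (sqrt \<rho>) :: complex"
  have q: "?q * ?q = of_real \<rho>" "cnj ?q = ?q" using \<rho>(1) by (simp_all flip: of_real_mult)
  \<comment> \<open>The value v is \<open>?q\<close> times the quotient of
    \<open>A x z / B x z\<close> by \<open>A z0 z / B z0 z\<close>. The cross-multiplied form holds
    for all z at once, so any generic z may be used later to evaluate it.\<close>
  have "\<exists>v. \<forall>z\<in>X. v * (B x z * A z0 z) = ?q * (A x z * B z0 z)" if x: "x \<in> X" for x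
  proof -
    obtain z1 where z1: "z1 \<in> X" "A x z1 \<noteq> 0" "B x z1 \<noteq> 0" "A z0 z1 \<noteq> 0" "B z0 z1 \<noteq> 0"
      using generic[of "{x, z0}"] x z0 by auto
    let ?v = "?q * (A x z1 * B z0 z1) / (B x z1 * A z0 z1)"
    have "?v * (B x z * A z0 z) = ?q * (A x z * B z0 z)" if z: "z \<in> X" for z
    proof -
      have "A x z * A z0 z1 * (B x z1 * B z0 z) = A x z1 * A z0 z * (B x z * B z0 z1)"
        by (rule cr[OF x z z0 z1(1)])
      then show ?thesis using z1 by (simp add: field_simps)
    qed
    then show ?thesis by blast
  qed
  then obtain \<omega> where \<omega>: "\<And>x z. x \<in> X \<Longrightarrow> z \<in> X \<Longrightarrow> \<omega> x * (B x z * A z0 z) = ?q * (A x z * B z0 z)"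
    by metis
  have "A x y = \<omega> x * cnj (\<omega> y) * B x y" if x: "x \<in> X" and y: "y \<in> X" for x y
  proof -
    obtain z where z: "z \<in> X" and nx: "A x z \<noteq> 0" "B x z \<noteq> 0" and ny: "A y z \<noteq> 0" "B y z \<noteq> 0"
      and n0: "A z0 z \<noteq> 0" "B z0 z \<noteq> 0"
      using generic[of "{x, y, z0}"] x y z0 by auto
    define R where "R u = A u z / B u z" for u
    have ratio: "A u v = R u * cnj (R v) * (B z z / A z z) * B u v"
      if u: "u \<in> X" "B u z \<noteq> 0" and v: "v \<in> X" "B v z \<noteq> 0" for u v
    proof -
      have "A u v * A z z * (B u z * cnj (B v z)) = A u z * cnj (A v z) * (B u v * B z z)"
        using cr[OF u(1) v(1) z z] herm[OF v(1) z] by simp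
      then show ?thesis using u v nz[OF z] by (simp add: R_def field_simps)
    qed
    have R0: "R z0 \<noteq> 0" using n0 by (simp add: R_def)
    have \<omega>R: "\<omega> u = ?q * R u / R z0" if "u \<in> X" "B u z \<noteq> 0" for u
      using \<omega>[OF that(1) z] that(2) n0 by (simp add: R_def field_simps)
    \<comment> \<open>Evaluating \<open>ratio\<close> at \<open>z0\<close> identifies the factor
      \<open>B z z / A z z\<close>, which depends on the auxiliary point.\<close>
    have "of_real \<rho> = R z0 * cnj (R z0) * (B z z / A z z)"
    proof -
      have "of_real \<rho> * B z0 z0 = (R z0 * cnj (R z0) * (B z z / A z z)) * B z0 z0"
        unfolding \<rho>(2) by (rule ratio[OF z0 n0(2) z0 n0(2)])
      then show ?thesis using nz(2)[OF z0] by (simp only: mult_cancel_right) simp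
    qed
    moreover have "\<omega> x * cnj (\<omega> y) = of_real \<rho> * (R x * cnj (R y)) / (R z0 * cnj (R z0))"
      unfolding \<omega>R[OF x nx(2)] \<omega>R[OF y ny(2)] q(1)[symmetric] by (simp add: q(2) field_simps)
    ultimately have "\<omega> x * cnj (\<omega> y) = R x * cnj (R y) * (B z z / A z z)"
      using R0 by (simp add: field_simps)
    then show ?thesis using ratio[OF x nx(2) y ny(2)] by simp
  qed
  then show ?thesis using A B unfolding rescaling_def by blast
qed

lemma psd_kernel_reindex:
  assumes L: "psd_kernel X L" and \<Phi>: "\<And>x. x \<in> Y \<Longrightarrow> \<Phi> x \<in> X"
  shows "psd_kernel Y (\<lambda>x y. L (\<Phi> x) (\<Phi> y))"
  unfolding psd_kernel_def
proof (intro allI impI)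
  fix m :: nat and x :: "nat \<Rightarrow> _" assume "\<forall>i<m. x i \<in> Y"
  then show "psd_matrix m (\<lambda>i j. L (\<Phi> (x i)) (\<Phi> (x j)))"
    using L[unfolded psd_kernel_def, rule_format, of m "\<lambda>i. \<Phi> (x i)"] \<Phi> by simp
qed

lemma nondegenerate_reindex:
  "nondegenerate X L \<Longrightarrow> (\<And>x. x \<in> Y \<Longrightarrow> \<Phi> x \<in> X) \<Longrightarrow> nondegenerate Y (\<lambda>x y. L (\<Phi> x) (\<Phi> y))"
  unfolding nondegenerate_def by blast

lemma projectively_invariant_kernelD:
  assumes "projectively_invariant_kernel X K"
  shows "sesqui_holomorphic X K" "nondegenerate X K" "psd_kernel X K"
    "\<Phi> \<in> Aut X \<Longrightarrow> \<exists>\<omega>. \<forall>x\<in>X. \<forall>y\<in>X. K (\<Phi> x) (\<Phi> y) = \<omega> x * cnj (\<omega> y) * K x y"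
  using assms unfolding projectively_invariant_kernel_def projectively_invariant_def rescaling_def
  by auto

lemma projectively_invariant_kernelI:
  assumes "sesqui_holomorphic X K" and K: "nondegenerate X K" and "psd_kernel X K"
    and "\<And>\<Phi>. \<Phi> \<in> Aut X \<Longrightarrow> \<exists>\<omega>. \<forall>x\<in>X. \<forall>y\<in>X. K (\<Phi> x) (\<Phi> y) = \<omega> x * cnj (\<omega> y) * K x y"
  shows "projectively_invariant_kernel X K"
  using assms nondegenerate_reindex[OF K Aut_mem]
  unfolding projectively_invariant_kernel_def projectively_invariant_def rescaling_def
  by auto

text \<open>The route for powers and limits, where no global rescaling factor is at hand.\<close>

lemma projectively_invariant_kernelI_cross_ratios:
  assumes X: "open X" "connected X"
    and K: "sesqui_holomorphic X K" "nondegenerate X K" "psd_kernel X K"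
    and cr: "\<And>\<Phi>. \<Phi> \<in> Aut X \<Longrightarrow> same_cross_ratios X (\<lambda>x y. K (\<Phi> x) (\<Phi> y)) K"
  shows "projectively_invariant_kernel X K"
  unfolding projectively_invariant_kernel_def projectively_invariant_def
proof (intro conjI ballI K)
  fix \<Phi> assume \<Phi>: "\<Phi> \<in> Aut X"
  show "rescaling X (\<lambda>x y. K (\<Phi> x) (\<Phi> y)) K"
    by (rule rescaling_of_same_cross_ratios[OF X sesqui_holomorphic_compose[OF K(1) \<Phi>] _ _ K cr[OF \<Phi>]])
      (rule nondegenerate_reindex[OF K(2) Aut_mem[OF \<Phi>]] psd_kernel_reindex[OF K(3) Aut_mem[OF \<Phi>]], assumption)+
qed

section \<open>The four closure properties\<close>

lemma projectively_invariant_kernel_mult: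
  assumes K: "projectively_invariant_kernel X K" and L: "projectively_invariant_kernel X L"
  shows "projectively_invariant_kernel X (\<lambda>x y. K x y * L x y)"
proof (rule projectively_invariant_kernelI)
  note K' = projectively_invariant_kernelD[OF K] and L' = projectively_invariant_kernelD[OF L]
  show "sesqui_holomorphic X (\<lambda>x y. K x y * L x y)" "psd_kernel X (\<lambda>x y. K x y * L x y)"
    by (intro sesqui_holomorphic_mult psd_kernel_mult K' L')+
  show "nondegenerate X (\<lambda>x y. K x y * L x y)"
    using K'(2) L'(2) unfolding nondegenerate_def by (auto simp: complex_is_Real_iff)
  fix \<Phi> assume "\<Phi> \<in> Aut X"
  then obtain \<psi> \<eta> where
      "\<forall>x\<in>X. \<forall>y\<in>X. K (\<Phi> x) (\<Phi> y) = \<psi> x * cnj (\<psi> y) * K x y"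
      "\<forall>x\<in>X. \<forall>y\<in>X. L (\<Phi> x) (\<Phi> y) = \<eta> x * cnj (\<eta> y) * L x y"
    using K'(4) L'(4) by blast
  then show "\<exists>\<omega>. \<forall>x\<in>X. \<forall>y\<in>X. K (\<Phi> x) (\<Phi> y) * L (\<Phi> x) (\<Phi> y) = \<omega> x * cnj (\<omega> y) * (K x y * L x y)"
    by (intro exI[of _ "\<lambda>x. \<psi> x * \<eta> x"]) (simp add: mult_ac)
qed

lemma projectively_invariant_kernel_prod:
  assumes "finite I" "I \<noteq> {}" "\<And>i. i \<in> I \<Longrightarrow> projectively_invariant_kernel X (K i)"
  shows "projectively_invariant_kernel X (\<lambda>x y. \<Prod>i\<in>I. K i x y)"
  using assms
  by (induction I rule: finite_ne_induct) (auto intro: projectively_invariant_kernel_mult)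

lemma projectively_invariant_kernel_rescaling:
  assumes L: "projectively_invariant_kernel X L" and M: "rescaling X M L" "sesqui_holomorphic X M"
  shows "projectively_invariant_kernel X M"
proof (rule projectively_invariant_kernelI)
  note L' = projectively_invariant_kernelD[OF L]
  show nd: "nondegenerate X M" using M(1) unfolding rescaling_def by blast
  obtain \<omega> where \<omega>: "\<And>x y. x \<in> X \<Longrightarrow> y \<in> X \<Longrightarrow> M x y = \<omega> x * cnj (\<omega> y) * L x y"
    using M(1) unfolding rescaling_def by blast
  show "psd_kernel X M" by (rule psd_kernel_rescale[OF L'(3) \<omega>])
  have \<omega>0: "\<omega> x \<noteq> 0" if "x \<in> X" for x
    using nondegenerate_nonzero[OF nd that] \<omega>[OF that that] by auto
  fix \<Phi> assume \<Phi>: "\<Phi> \<in> Aut X"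
  then obtain \<psi> where \<psi>: "\<And>x y. x \<in> X \<Longrightarrow> y \<in> X \<Longrightarrow> L (\<Phi> x) (\<Phi> y) = \<psi> x * cnj (\<psi> y) * L x y"
    using L'(4) by blast
  \<comment> \<open>Pass from \<open>M\<close> to \<open>L\<close> at the image points, apply
    \<Phi>, and return to \<open>M\<close>; non-degeneracy of \<open>M\<close> has made \<omega>
    non-zero.\<close>
  have "M (\<Phi> x) (\<Phi> y) = (\<omega> (\<Phi> x) * \<psi> x / \<omega> x) * cnj (\<omega> (\<Phi> y) * \<psi> y / \<omega> y) * M x y"
    if "x \<in> X" "y \<in> X" for x y
    using that \<omega>0 by (simp add: \<omega> \<psi> Aut_mem[OF \<Phi>])
  then show "\<exists>\<eta>. \<forall>x\<in>X. \<forall>y\<in>X. M (\<Phi> x) (\<Phi> y) = \<eta> x * cnj (\<eta> y) * M x y"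
    by (intro exI[of _ "\<lambda>x. \<omega> (\<Phi> x) * \<psi> x / \<omega> x"]) blast
qed (fact M(2))

text \<open>Near a point \<open>a\<close>, the factor \<open>\<psi>\<close> by which \<open>\<Phi>\<close> rescales \<open>K\<close> is holomorphic up to a
  constant, so it has a holomorphic power \<open>w\<close>; on the diagonal \<open>\<bar>w\<bar>\<^sup>2\<close> rescales \<open>P\<close>, hence so does
  \<open>w\<close> near the diagonal. There may be no global power of \<open>\<psi>\<close>, but equality
  of cross ratios continues analytically.\<close>

lemma projectively_invariant_kernel_power:
  fixes K P :: "complex ^ 'n \<Rightarrow> complex ^ 'n \<Rightarrow> complex"
  assumes X: "open X" "connected X" and K: "projectively_invariant_kernel X K"
    and P: "is_kernel_power X K s P" and psd: "psd_kernel X P"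
  shows "projectively_invariant_kernel X P"
proof (rule projectively_invariant_kernelI_cross_ratios[OF X _ _ psd])
  note K' = projectively_invariant_kernelD[OF K]
  show Ps: "sesqui_holomorphic X P" using P unfolding is_kernel_power_def by blast
  have Pd: "P x x = of_real (Re (K x x) powr s)" if "x \<in> X" for x
    using P that unfolding is_kernel_power_def by blast
  have Kd: "Re (K x x) > 0" "K x x = of_real (Re (K x x))" if "x \<in> X" for x
    using K'(2) that unfolding nondegenerate_def by auto
  show "nondegenerate X P"
    unfolding nondegenerate_def
  proof
    fix x assume "x \<in> X"
    then show "P x x \<in> \<real> \<and> 0 < Re (P x x)" using Kd(1)[of x] by (simp add: Pd)
  qed
  fix \<Phi> assume \<Phi>: "\<Phi> \<in> Aut X"
  note \<Phi>X = Aut_mem[OF \<Phi>]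
  have P\<Phi>: "sesqui_holomorphic X (\<lambda>x y. P (\<Phi> x) (\<Phi> y))"
    by (rule sesqui_holomorphic_compose[OF Ps \<Phi>])
  show "same_cross_ratios X (\<lambda>x y. P (\<Phi> x) (\<Phi> y)) P"
  proof (cases "X = {}")
    case True
    then show ?thesis by (simp add: same_cross_ratios_def)
  next
    case False
    then obtain a where a: "a \<in> X" by blast
    obtain \<psi> where \<psi>: "\<And>x y. x \<in> X \<Longrightarrow> y \<in> X \<Longrightarrow> K (\<Phi> x) (\<Phi> y) = \<psi> x * cnj (\<psi> y) * K x y"
      using K'(4)[OF \<Phi>] by blast
    have \<psi>0: "\<psi> x \<noteq> 0" if "x \<in> X" for x
      using nondegenerate_nonzero[OF K'(2) \<Phi>X[OF that]] \<psi>[OF that that] by auto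
    define U where "U = {x \<in> X. K x a \<noteq> 0}"
    \<comment> \<open>Putting y = a in the rescaling identity expresses \<psi> through
      \<open>K\<close>; \<open>u\<close> is \<psi> divided by its value at \<open>a\<close>, so it
      is holomorphic where \<open>K x a\<close> is non-zero, and \<open>u a = 1\<close>.\<close>
    define u where "u x = K (\<Phi> x) (\<Phi> a) * inverse (K x a) * inverse (\<psi> a * cnj (\<psi> a))" for x
    have u: "\<psi> x = \<psi> a * u x" if "x \<in> U" for x
      using that \<psi>0[OF a] by (simp add: u_def U_def \<psi>[OF _ a] inverse_eq_divide)
    have contK: "continuous_on X (\<lambda>x. K x a)"
      by (rule holomorphic_fun_on_imp_continuous_on[OF sesqui_holomorphicD(1)[OF K'(1) a]])
    have UX: "U \<subseteq> X" unfolding U_def by auto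
    have "U = X \<inter> (\<lambda>x. K x a) -` (- {0})" unfolding U_def by auto
    then have Uo: "open U"
      using continuous_open_preimage[OF contK X(1) open_Compl[OF closed_singleton]] by metis
    have uh: "holomorphic_fun_on u U"
      unfolding u_def
    proof (intro holomorphic_fun_on_mult holomorphic_fun_on_const)
      show "holomorphic_fun_on (\<lambda>x. K (\<Phi> x) (\<Phi> a)) U"
        by (rule holomorphic_fun_on_subset[OF sesqui_holomorphicD(1)[OF sesqui_holomorphic_compose[OF K'(1) \<Phi>] a] UX])
      show "holomorphic_fun_on (\<lambda>x. inverse (K x a)) U"
        by (rule holomorphic_fun_on_compose_field[OF holomorphic_fun_on_subset[OF sesqui_holomorphicD(1)[OF K'(1) a] UX]])
          (auto simp: U_def intro: field_differentiable_inverse)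
    qed
    \<comment> \<open>The disc of radius 1 about 1 lies in the right half plane, off the branch cut
      of \<open>Ln\<close>.\<close>
    define W where "W = U \<inter> u -` ball 1 1"
    have W: "open W" "W \<subseteq> U"
      unfolding W_def
      using continuous_open_preimage[OF holomorphic_fun_on_imp_continuous_on[OF uh] Uo open_ball] by auto
    have aU: "a \<in> U" using a nondegenerate_nonzero[OF K'(2) a] by (simp add: U_def)
    have "u a = 1" using u[OF aU] \<psi>0[OF a] by simp
    then have aW: "a \<in> W" using aU by (simp add: W_def)
    define w where "w x = exp (of_real s * Ln (u x))" for x
    have wh: "holomorphic_fun_on w W"
      unfolding w_def
    proof (rule holomorphic_fun_on_compose_field[OF holomorphic_fun_on_subset[OF uh W(2)]])
      fix x assume "x \<in> W"
      then have "dist 1 (u x) < 1" by (simp add: W_def)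
      then have "0 < Re (u x)"
        using complex_Re_le_cmod[of "1 - u x"] by (simp add: dist_norm)
      then have "u x \<notin> \<real>\<^sub>\<le>\<^sub>0" by (simp add: complex_nonpos_Reals_iff)
      then have "((\<lambda>z. exp (of_real s * Ln z)) has_field_derivative
          exp (of_real s * Ln (u x)) * (of_real s * inverse (u x))) (at (u x))"
        by (auto intro!: derivative_eq_intros)
      then show "(\<lambda>z. exp (of_real s * Ln z)) field_differentiable at (u x)"
        unfolding field_differentiable_def by blast
    qed
    \<comment> \<open>The contribution of the constant \<open>\<psi> a\<close>, which was divided
      out of \<open>u\<close>, to the power of the squared modulus of \<psi>.\<close>
    define C where "C = (cmod (\<psi> a))\<^sup>2 powr s"
    define G where "G x y = P (\<Phi> x) (\<Phi> y) - of_real C * (w x * cnj (w y)) * P x y" for x y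
    have WX: "W \<subseteq> X" using W(2) UX by blast
    have "sesqui_holomorphic W G"
      unfolding G_def
      by (intro sesqui_holomorphic_diff sesqui_holomorphic_mult sesqui_holomorphic_const
          sesqui_holomorphic_rank_one wh sesqui_holomorphic_subset[OF P\<Phi> WX] sesqui_holomorphic_subset[OF Ps WX])
    moreover have "G x x = 0" if x: "x \<in> W" for x
    proof -
      have xX: "x \<in> X" and xU: "x \<in> U" using x WX W(2) by auto
      have u0: "u x \<noteq> 0" using \<psi>0[OF xX] u[OF xU] by auto
      have "Re (K (\<Phi> x) (\<Phi> x)) = (cmod (\<psi> a))\<^sup>2 * (cmod (u x) * cmod (u x)) * Re (K x x)"
      proof -
        have "K (\<Phi> x) (\<Phi> x) = of_real ((cmod (\<psi> x))\<^sup>2 * Re (K x x))"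
          unfolding \<psi>[OF xX xX] of_real_mult complex_norm_square by (subst Kd(2)[OF xX]) simp
        then show ?thesis by (simp add: u[OF xU] norm_mult power2_eq_square)
      qed
      moreover have "of_real (cmod (u x) powr s * cmod (u x) powr s) = w x * cnj (w x)"
      proof -
        \<comment> \<open>The modulus of an exponential depends only on the real part of the
          exponent, here s times the logarithm of the modulus of \<open>u x\<close>.\<close>
        have "cmod (w x) = cmod (u x) powr s"
          using u0 by (simp add: w_def powr_def)
        then show ?thesis by (simp add: complex_norm_square[symmetric] power2_eq_square[symmetric] del: of_real_mult)
      qed
      ultimately show ?thesis
        using Kd(1)[OF xX]
        by (simp add: G_def Pd[OF xX] Pd[OF \<Phi>X[OF xX]] C_def powr_mult)
    qed
    ultimately obtain V where V: "open V" "V \<noteq> {}" "V \<subseteq> W" "\<And>x y. x \<in> V \<Longrightarrow> y \<in> V \<Longrightarrow> G x y = 0"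
      using sesqui_holomorphic_diagonal_zero[OF W(1), of G] aW by blast
    have "same_cross_ratios V (\<lambda>x y. P (\<Phi> x) (\<Phi> y)) P"
      by (rule same_cross_ratios_rescale[of _ _ "of_real C" w]) (use V(4) in \<open>simp add: G_def\<close>)
    then show ?thesis
      by (rule same_cross_ratios_extend[OF X V(1,2) subset_trans[OF V(3) WX] P\<Phi> Ps])
  qed
qed

text \<open>Freezing one variable at \<open>a\<close> turns a compact \<open>C\<close> into the
  compact slice \<open>C \<times> {a}\<close> or \<open>{a} \<times> C\<close>, so Weierstrass'
  theorem applies in each variable separately.\<close>

lemma sesqui_holomorphic_limit:
  fixes K :: "'i \<Rightarrow> complex ^ 'n \<Rightarrow> complex ^ 'n \<Rightarrow> complex"
  assumes X: "open X" and F: "F \<noteq> bot" and K: "\<forall>\<^sub>F i in F. sesqui_holomorphic X (K i)"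
    and lim: "\<And>C. compact C \<Longrightarrow> C \<subseteq> X \<times> X \<Longrightarrow> uniform_limit C (\<lambda>i. case_prod (K i)) (case_prod L) F"
  shows "sesqui_holomorphic X L"
  unfolding sesqui_holomorphic_def antiholomorphic_fun_on_def
proof (intro conjI ballI)
  fix a assume a: "a \<in> X"
  show "holomorphic_fun_on (\<lambda>x. L x a) X"
  proof (rule holomorphic_fun_on_uniform_limit[OF X F])
    show "\<forall>\<^sub>F i in F. holomorphic_fun_on (\<lambda>x. K i x a) X"
      using K by eventually_elim (rule sesqui_holomorphicD(1)[OF _ a])
    fix C :: "(complex ^ 'n) set" assume C: "compact C" "C \<subseteq> X"
    have "uniform_limit (C \<times> {a}) (\<lambda>i. case_prod (K i)) (case_prod L) F"
      using C a by (intro lim compact_Times) auto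
    then show "uniform_limit C (\<lambda>i x. K i x a) (\<lambda>x. L x a) F"
      unfolding uniform_limit_iff by simp
  qed
  show "holomorphic_fun_on (\<lambda>y. cnj (L a y)) X"
  proof (rule holomorphic_fun_on_uniform_limit[OF X F])
    show "\<forall>\<^sub>F i in F. holomorphic_fun_on (\<lambda>y. cnj (K i a y)) X"
      using K by eventually_elim (rule sesqui_holomorphicD(2)[OF _ a])
    fix C :: "(complex ^ 'n) set" assume C: "compact C" "C \<subseteq> X"
    have "uniform_limit ({a} \<times> C) (\<lambda>i. case_prod (K i)) (case_prod L) F"
      using C a by (intro lim compact_Times) auto
    then show "uniform_limit C (\<lambda>i y. cnj (K i a y)) (\<lambda>y. cnj (L a y)) F"
      unfolding uniform_limit_iff by (simp add: dist_norm flip: complex_cnj_diff)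
  qed
qed

text \<open>The factors belonging to the \<open>K i\<close> are chosen separately and need not
  converge. Both sides of the cross ratio identity are products of finitely many kernel values, so
  the identity itself passes to the limit.\<close>

lemma projectively_invariant_kernel_limit:
  fixes K :: "'i \<Rightarrow> complex ^ 'n \<Rightarrow> complex ^ 'n \<Rightarrow> complex"
  assumes X: "open X" "connected X" and F: "F \<noteq> bot"
    and K: "\<forall>\<^sub>F i in F. projectively_invariant_kernel X (K i)"
    and lim: "limitin (compact_open_topology (X \<times> X)) (\<lambda>i. case_prod (K i)) (case_prod L) F"
    and L: "nondegenerate X L"
  shows "projectively_invariant_kernel X L"
proof (rule projectively_invariant_kernelI_cross_ratios[OF X _ L])
  note ulim = limitin_compact_open_imp_uniform_limit[OF lim]
  have plim: "((\<lambda>i. K i x y) \<longlongrightarrow> L x y) F" if "x \<in> X" "y \<in> X" for x y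
    using tendsto_uniform_limitI[OF ulim[of "{(x, y)}"], of "(x, y)"] that by simp
  show "sesqui_holomorphic X L"
    by (rule sesqui_holomorphic_limit[OF X(1) F _ ulim])
      (rule eventually_mono[OF K projectively_invariant_kernelD(1)])
  show "psd_kernel X L"
    by (rule psd_kernel_limit[OF F _ plim])
      (rule eventually_mono[OF K projectively_invariant_kernelD(3)])
  fix \<Phi> assume \<Phi>: "\<Phi> \<in> Aut X"
  note \<Phi>X = Aut_mem[OF \<Phi>]
  show "same_cross_ratios X (\<lambda>x y. L (\<Phi> x) (\<Phi> y)) L"
    unfolding same_cross_ratios_def
  proof (intro ballI)
    fix x y z w assume X4: "x \<in> X" "y \<in> X" "z \<in> X" "w \<in> X"
    let ?l = "\<lambda>K. K (\<Phi> x) (\<Phi> y) * K (\<Phi> z) (\<Phi> w) * (K x w * K z y) :: complex"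
    let ?r = "\<lambda>K. K (\<Phi> x) (\<Phi> w) * K (\<Phi> z) (\<Phi> y) * (K x y * K z w) :: complex"
    have l: "((\<lambda>i. ?l (K i)) \<longlongrightarrow> ?l L) F" and r: "((\<lambda>i. ?r (K i)) \<longlongrightarrow> ?r L) F"
      by (intro tendsto_mult plim \<Phi>X X4)+
    have "\<forall>\<^sub>F i in F. ?l (K i) = ?r (K i)"
      using K
    proof eventually_elim
      case (elim i)
      then obtain \<psi> where "\<And>x y. x \<in> X \<Longrightarrow> y \<in> X \<Longrightarrow> K i (\<Phi> x) (\<Phi> y) = \<psi> x * cnj (\<psi> y) * K i x y"
        using projectively_invariant_kernelD(4)[OF elim \<Phi>] by blast
      then have "same_cross_ratios X (\<lambda>x y. K i (\<Phi> x) (\<Phi> y)) (K i)"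
        by (intro same_cross_ratios_rescale[of _ _ 1 \<psi>]) simp
      then show ?case using X4 unfolding same_cross_ratios_def by blast
    qed
    then show "?l L = ?r L"
      by (rule tendsto_unique[OF F r Lim_transform_eventually[OF l], symmetric])
  qed
qed

theorem proposition4p4:
  fixes X :: "(complex ^ 'n) set"
  assumes "open X" and "connected X"
  shows
    "(\<forall>(I :: 'j set) K. finite I \<longrightarrow> I \<noteq> {} \<longrightarrow>
        (\<forall>i\<in>I. projectively_invariant_kernel X (K i)) \<longrightarrow>
        projectively_invariant_kernel X (\<lambda>x y. \<Prod>i\<in>I. K i x y))
   \<and> (\<forall>L M. projectively_invariant_kernel X L \<longrightarrow> rescaling X M L \<longrightarrow> sesqui_holomorphic X M \<longrightarrow>
        projectively_invariant_kernel X M)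
   \<and> (\<forall>K (s :: real) P. projectively_invariant_kernel X K \<longrightarrow>
        is_kernel_power X K s P \<longrightarrow> psd_kernel X P \<longrightarrow>
        projectively_invariant_kernel X P)
   \<and> (\<forall>(F :: 'i filter) K L. F \<noteq> bot \<longrightarrow>
        (\<forall>\<^sub>F i in F. projectively_invariant_kernel X (K i)) \<longrightarrow>
        limitin (compact_open_topology (X \<times> X)) (\<lambda>i. case_prod (K i)) (case_prod L) F \<longrightarrow>
        nondegenerate X L \<longrightarrow>
        projectively_invariant_kernel X L)"
proof (intro conjI allI impI)
  fix I :: "'j set" and K
  assume "finite I" "I \<noteq> {}" "\<forall>i\<in>I. projectively_invariant_kernel X (K i)"
  then show "projectively_invariant_kernel X (\<lambda>x y. \<Prod>i\<in>I. K i x y)"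
    by (intro projectively_invariant_kernel_prod) auto
next
  fix L M
  assume "projectively_invariant_kernel X L" "rescaling X M L" "sesqui_holomorphic X M"
  then show "projectively_invariant_kernel X M"
    by (rule projectively_invariant_kernel_rescaling)
next
  fix K P and s :: real
  assume "projectively_invariant_kernel X K" "is_kernel_power X K s P" "psd_kernel X P"
  then show "projectively_invariant_kernel X P"
    by (rule projectively_invariant_kernel_power[OF assms])
next
  fix F :: "'i filter" and K L
  assume "F \<noteq> bot" "\<forall>\<^sub>F i in F. projectively_invariant_kernel X (K i)"
    "limitin (compact_open_topology (X \<times> X)) (\<lambda>i. case_prod (K i)) (case_prod L) F"
    "nondegenerate X L"
  then show "projectively_invariant_kernel X L"
    by (rule projectively_invariant_kernel_limit[OF assms])
qed

end
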